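(* Let $\mathcal{V}$ be a variety of ai-semirings. Suppose that for each positive integer $n$ there exists an ai-semiring $S_n$ in $\mathcal{V}$ whose multiplicative reduct is (isomorphic to) the semigroup $S_c(a_1\cdots a_n)$, where $a_1,\dots,a_n$ are distinct letters. Then $\mathcal{V}$ is of type $2^{\aleph_0}$, i.e. $\mathcal{V}$ has exactly $2^{\aleph_0}$ subvarieties.
   Context: A semiring is an algebra $(S,+,\cdot)$ with two binary operations (no constants in the signature) such that $(S,+)$ is a commutative semigroup, $(S,\cdot)$ is a semigroup, and $(x+y)z= xz+yz$, $x(y+z)= xy+xz$ hold. An ai-semiring (additively idempotent semiring) is a semiring satisfying $x+x= x$. The multiplicative reduct of $(S,+,\cdot)$ is the semigroup $(S,\cdot)$. A variety is a class of algebras (of this signature) closed under subalgebras, homomorphic images and arbitrary direct products; equivalently, an equational class. A variety is of type $2^{\aleph_0}$ if its set of subvarieties has cardinality $2^{\aleph_0}$. The semigroup $S_c(a_1\cdots a_n)$: its elements are a zero $0$ together with all nonempty subwords (i.e. divisors different from $1$) of the word $a_1\cdots a_n$ in the free commutative semigroup on the distinct letters $a_1,\dots,a_n$, that is, all products $\prod_{i\in I}a_i$ with $\emptyset\ne I\subseteq\{1,\dots,n\}$. The product of two nonzero elements $\mathbf u,\mathbf v$ is their commutative product $\mathbf u\mathbf v$ if this is again a subword of $a_1\cdots a_n$ (i.e. if the corresponding index sets are disjoint), and $0$ otherwise; $0$ is a multiplicative zero. *)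

theory Defs
  imports
    "HOL-Library.FuncSet"
    "HOL-Library.Multiset"
    "HOL-Library.Equipollence"
    "HOL-Library.Infinite_Typeclass"
begin

subsection \<open>Semirings\<close>

record 'a mult_struct =
  carrier :: "'a set"
  mult :: "'a \<Rightarrow> 'a \<Rightarrow> 'a"

record 'a alg = "'a mult_struct" +
  add :: "'a \<Rightarrow> 'a \<Rightarrow> 'a"

text \<open>As usual in universal algebra, carriers are nonempty. The operations are only relevant on
  the carrier.\<close>

definition algebra :: "'a alg \<Rightarrow> bool" where
  "algebra A \<longleftrightarrow> carrier A \<noteq> {} \<and>
     (\<forall>x\<in>carrier A. \<forall>y\<in>carrier A. add A x y \<in> carrier A \<and> mult A x y \<in> carrier A)"

definition semiring :: "'a alg \<Rightarrow> bool" where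
  "semiring S \<longleftrightarrow> algebra S \<and>
     (\<forall>x\<in>carrier S. \<forall>y\<in>carrier S. add S x y = add S y x) \<and>
     (\<forall>x\<in>carrier S. \<forall>y\<in>carrier S. \<forall>z\<in>carrier S.
        add S (add S x y) z = add S x (add S y z) \<and>
        mult S (mult S x y) z = mult S x (mult S y z) \<and>
        mult S (add S x y) z = add S (mult S x z) (mult S y z) \<and>
        mult S x (add S y z) = add S (mult S x y) (mult S x z))"

definition ai_semiring :: "'a alg \<Rightarrow> bool" where
  "ai_semiring S \<longleftrightarrow> semiring S \<and> (\<forall>x\<in>carrier S. add S x x = x)"

definition mult_reduct :: "'a alg \<Rightarrow> 'a mult_struct" where
  "mult_reduct S = mult_struct.truncate S"

definition mult_isomorphic :: "'a mult_struct \<Rightarrow> 'b mult_struct \<Rightarrow> bool" where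
  "mult_isomorphic S T \<longleftrightarrow> (\<exists>f. bij_betw f (carrier S) (carrier T) \<and>
     (\<forall>x\<in>carrier S. \<forall>y\<in>carrier S. f (mult S x y) = mult T (f x) (f y)))"


subsection \<open>The semigroups S_c\<close>

text \<open>The elements of the free commutative semigroup are the nonempty multisets of letters, and
  its multiplication is the sum of multisets. The zero adjoined to the set of subwords of the
  word \<open>w\<close> is \<^term>\<open>None\<close>.\<close>

definition S_c :: "'l multiset \<Rightarrow> 'l multiset option mult_struct" where
  "S_c w = \<lparr>
     carrier = insert None (Some ` {u. u \<noteq> {#} \<and> u \<subseteq># w}),
     mult = (\<lambda>x y. case (x, y) of
         (Some u, Some v) \<Rightarrow> if u + v \<subseteq># w then Some (u + v) else None
       | _ \<Rightarrow> None) \<rparr>"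


subsection \<open>Varieties\<close>

definition hom :: "'a alg \<Rightarrow> 'b alg \<Rightarrow> ('a \<Rightarrow> 'b) set" where
  "hom A B = {f \<in> carrier A \<rightarrow> carrier B. \<forall>x\<in>carrier A. \<forall>y\<in>carrier A.
     f (add A x y) = add B (f x) (f y) \<and> f (mult A x y) = mult B (f x) (f y)}"

definition homomorphic_image :: "'b alg \<Rightarrow> 'a alg \<Rightarrow> bool" where
  "homomorphic_image B A \<longleftrightarrow> algebra B \<and> (\<exists>f\<in>hom A B. f ` carrier A = carrier B)"

definition isomorphic :: "'a alg \<Rightarrow> 'b alg \<Rightarrow> bool" where
  "isomorphic A B \<longleftrightarrow> (\<exists>f\<in>hom A B. bij_betw f (carrier A) (carrier B))"

definition subalgebra :: "'a alg \<Rightarrow> 'a alg \<Rightarrow> bool" where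
  "subalgebra B A \<longleftrightarrow> algebra B \<and> carrier B \<subseteq> carrier A \<and>
     (\<forall>x\<in>carrier B. \<forall>y\<in>carrier B. add B x y = add A x y \<and> mult B x y = mult A x y)"

definition direct_product :: "'i set \<Rightarrow> ('i \<Rightarrow> 'a alg) \<Rightarrow> ('i \<Rightarrow> 'a) alg" where
  "direct_product I A = \<lparr>
     carrier = (\<Pi>\<^sub>E i\<in>I. carrier (A i)),
     mult = (\<lambda>f g. \<lambda>i\<in>I. mult (A i) (f i) (g i)),
     add = (\<lambda>f g. \<lambda>i\<in>I. add (A i) (f i) (g i)) \<rparr>"

text \<open>
  A class of algebras is represented by its members with carrier contained in an arbitrary
  infinite type \<open>'u\<close>. A direct product of members need not fit into \<open>'u\<close> (an infinite power of
  a two-element algebra does not fit into a countable type), so closure under direct products is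
  required for every algebra over \<open>'u\<close> that is isomorphic to a subalgebra of a direct product.
  By Birkhoff's theorem, proved below as \<open>variety_iff_equational\<close>, the classes obtained are
  exactly the sets of all models over \<open>'u\<close> of sets of identities in countably many variables.
  Hence no information is lost: an identity that fails in some algebra fails in a countable
  subalgebra of it, so the varieties correspond bijectively to their traces on \<open>'u\<close>.
\<close>

definition variety :: "'u::infinite alg set \<Rightarrow> bool" where
  "variety K \<longleftrightarrow> (\<forall>A\<in>K. algebra A) \<and>
     (\<forall>A\<in>K. \<forall>B. subalgebra B A \<longrightarrow> B \<in> K) \<and>
     (\<forall>A\<in>K. \<forall>B. homomorphic_image B A \<longrightarrow> B \<in> K) \<and>
     (\<forall>(I :: 'u set) A P B. (\<forall>i\<in>I. A i \<in> K) \<longrightarrow> subalgebra P (direct_product I A) \<longrightarrow>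
        algebra B \<longrightarrow> isomorphic B P \<longrightarrow> B \<in> K)"

definition subvarieties :: "'u::infinite alg set \<Rightarrow> 'u alg set set" where
  "subvarieties V = {W. variety W \<and> W \<subseteq> V}"


subsection \<open>Varieties are the equational classes\<close>

datatype 'v trm = Var 'v | Add "'v trm" "'v trm" | Mult "'v trm" "'v trm"

primrec eval :: "'a alg \<Rightarrow> ('v \<Rightarrow> 'a) \<Rightarrow> 'v trm \<Rightarrow> 'a" where
  "eval A \<rho> (Var x) = \<rho> x"
| "eval A \<rho> (Add s t) = add A (eval A \<rho> s) (eval A \<rho> t)"
| "eval A \<rho> (Mult s t) = mult A (eval A \<rho> s) (eval A \<rho> t)"

definition satisfies :: "'a alg \<Rightarrow> 'v trm \<Rightarrow> 'v trm \<Rightarrow> bool" where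
  "satisfies A s t \<longleftrightarrow> (\<forall>\<rho>. range \<rho> \<subseteq> carrier A \<longrightarrow> eval A \<rho> s = eval A \<rho> t)"

definition models :: "(nat trm \<times> nat trm) set \<Rightarrow> 'a alg set" where
  "models \<Sigma> = {A. algebra A \<and> (\<forall>(s, t)\<in>\<Sigma>. satisfies A s t)}"

lemma eval_closed:
  assumes "algebra A" "range \<rho> \<subseteq> carrier A"
  shows "eval A \<rho> t \<in> carrier A"
  using assms by (induction t) (auto simp: algebra_def)

lemma eval_hom:
  assumes "algebra A" "range \<rho> \<subseteq> carrier A" "f \<in> hom A B"
  shows "f (eval A \<rho> t) = eval B (f \<circ> \<rho>) t"
  using assms(3) by (induction t) (auto simp: hom_def eval_closed[OF assms(1,2)])

lemma eval_map_trm: "eval A \<rho> (map_trm g t) = eval A (\<rho> \<circ> g) t"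
  by (induction t) auto

lemma eval_cong: "(\<And>x. x \<in> set_trm t \<Longrightarrow> \<rho> x = \<sigma> x) \<Longrightarrow> eval A \<rho> t = eval A \<sigma> t"
  by (induction t) auto

lemma finite_set_trm: "finite (set_trm t)"
  by (induction t) auto

lemma satisfies_if_separated:
  fixes B :: "'a alg" and A :: "'i \<Rightarrow> 'b alg" and s t :: "'v trm"
  assumes B: "algebra B"
    and h: "\<And>i. i \<in> I \<Longrightarrow> h i \<in> hom B (A i)"
    and sep: "\<And>x y. x \<in> carrier B \<Longrightarrow> y \<in> carrier B \<Longrightarrow> (\<And>i. i \<in> I \<Longrightarrow> h i x = h i y) \<Longrightarrow> x = y"
    and sat: "\<And>i. i \<in> I \<Longrightarrow> satisfies (A i) s t"
  shows "satisfies B s t"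
  unfolding satisfies_def
proof (intro allI impI)
  fix \<rho> :: "'v \<Rightarrow> 'a" assume \<rho>: "range \<rho> \<subseteq> carrier B"
  show "eval B \<rho> s = eval B \<rho> t"
  proof (rule sep)
    fix i assume i: "i \<in> I"
    have "range (h i \<circ> \<rho>) \<subseteq> carrier (A i)" using h[OF i] \<rho> by (auto simp: hom_def)
    then show "h i (eval B \<rho> s) = h i (eval B \<rho> t)"
      using sat[OF i] by (simp add: eval_hom[OF B \<rho> h[OF i]] satisfies_def)
  qed (use eval_closed[OF B \<rho>] in auto)
qed

lemma variety_models: "variety (models \<Sigma> :: 'u::infinite alg set)"
proof -
  have S: "B \<in> models \<Sigma>" if A: "A \<in> models \<Sigma>" and B: "subalgebra B A" for A B :: "'u alg"
  proof -
    have "satisfies B s t" if "satisfies A s t" for s t :: "nat trm"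
      by (rule satisfies_if_separated[where I = "{()}" and h = "\<lambda>_. id" and A = "\<lambda>_. A"])
        (use B that in \<open>auto simp: subalgebra_def hom_def\<close>)
    then show ?thesis using A B by (auto simp: models_def subalgebra_def)
  qed
  have H: "B \<in> models \<Sigma>" if A: "A \<in> models \<Sigma>" and im: "homomorphic_image B A"
    for A B :: "'u alg"
  proof -
    obtain f where f: "f \<in> hom A B" "f ` carrier A = carrier B" and B: "algebra B"
      using im by (auto simp: homomorphic_image_def)
    have "satisfies B s t" if st: "satisfies A s t" for s t :: "nat trm"
      unfolding satisfies_def
    proof (intro allI impI)
      fix \<rho> :: "nat \<Rightarrow> 'u" assume "range \<rho> \<subseteq> carrier B"
      then have "\<forall>x. \<rho> x \<in> f ` carrier A" using f(2) by auto
      then have "\<forall>x. \<exists>a. a \<in> carrier A \<and> \<rho> x = f a" by (simp add: image_iff Bex_def)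
      from choice[OF this] obtain \<sigma> where \<sigma>: "\<forall>x. \<sigma> x \<in> carrier A \<and> \<rho> x = f (\<sigma> x)" ..
      then have r: "range \<sigma> \<subseteq> carrier A" and \<rho>: "\<rho> = f \<circ> \<sigma>" by (auto simp: fun_eq_iff)
      have "algebra A" using A by (simp add: models_def)
      then show "eval B \<rho> s = eval B \<rho> t"
        using st r unfolding satisfies_def \<rho> by (simp flip: eval_hom[OF _ r f(1)])
    qed
    then show ?thesis using A B by (auto simp: models_def)
  qed
  have P: "B \<in> models \<Sigma>"
    if A: "\<forall>i\<in>I. A i \<in> models \<Sigma>" and P: "subalgebra P (direct_product I A)"
      and B: "algebra B" and iso: "isomorphic B P"
    for I :: "'u set" and A and P and B :: "'u alg"
  proof -
    obtain f where f: "f \<in> hom B P" "bij_betw f (carrier B) (carrier P)"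
      using iso by (auto simp: isomorphic_def)
    have fP: "f x \<in> carrier P" if "x \<in> carrier B" for x using f(1) that by (auto simp: hom_def)
    have Pe: "p \<in> (\<Pi>\<^sub>E i\<in>I. carrier (A i))" if "p \<in> carrier P" for p
      using P that by (auto simp: subalgebra_def direct_product_def)
    have "satisfies B s t" if st: "(s, t) \<in> \<Sigma>" for s t
    proof (rule satisfies_if_separated[OF B, where I = I and A = A and h = "\<lambda>i x. f x i"])
      fix i assume i: "i \<in> I"
      show "(\<lambda>x. f x i) \<in> hom B (A i)"
        using f(1) P i fP PiE_mem[OF Pe[OF fP] i]
        by (simp add: hom_def subalgebra_def direct_product_def)
      show "satisfies (A i) s t" using A i st by (auto simp: models_def)
    next
      fix x y assume xy: "x \<in> carrier B" "y \<in> carrier B" "\<And>i. i \<in> I \<Longrightarrow> f x i = f y i"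
      have "f x = f y" by (rule PiE_ext[OF Pe[OF fP] Pe[OF fP]]) (use xy in auto)
      then show "x = y" using f(2) xy by (auto simp: bij_betw_def inj_on_def)
    qed
    then show ?thesis using B by (auto simp: models_def)
  qed
  show ?thesis
    unfolding variety_def
  proof (intro conjI allI ballI impI)
    show "algebra A" if "A \<in> models \<Sigma>" for A :: "'u alg" using that by (simp add: models_def)
    show "B \<in> models \<Sigma>" if "A \<in> models \<Sigma>" "subalgebra B A" for A B :: "'u alg"
      using that by (rule S)
    show "B \<in> models \<Sigma>" if "A \<in> models \<Sigma>" "homomorphic_image B A" for A B :: "'u alg"
      using that by (rule H)
    show "B \<in> models \<Sigma>" if "\<forall>i\<in>I. A i \<in> models \<Sigma>" "subalgebra Q (direct_product I A)"
      "algebra B" "isomorphic B Q" for I :: "'u set" and A and Q and B :: "'u alg"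
      using that by (rule P)
  qed
qed

lemma inj_trm_encoding: "\<exists>enc :: 'u::infinite trm \<Rightarrow> 'u. inj enc"
proof -
  have "(UNIV :: 'u set) \<times> (UNIV :: 'u set) \<lesssim> (UNIV :: 'u set)"
    unfolding lepoll_def card_of_ordLeq
    using card_of_Times_same_infinite[OF infinite_UNIV] by (rule ordIso_imp_ordLeq)
  then obtain p :: "'u \<times> 'u \<Rightarrow> 'u" where p: "inj p" by (auto simp: lepoll_def)
  obtain c :: "nat \<Rightarrow> 'u" where c: "inj c"
    using infinite_countable_subset[OF infinite_UNIV] by blast
  define enc :: "'u trm \<Rightarrow> 'u" where
    "enc = rec_trm (\<lambda>x. p (c 0, x)) (\<lambda>_ _ a b. p (c 1, p (a, b))) (\<lambda>_ _ a b. p (c 2, p (a, b)))"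
  have [simp]: "p x = p y \<longleftrightarrow> x = y" "c i = c j \<longleftrightarrow> i = j" for x y i j
    using p c by (simp_all add: inj_eq)
  have "enc s = enc t \<Longrightarrow> s = t" for s t
  proof (induction s arbitrary: t)
    case (Var x) then show ?case by (cases t) (auto simp: enc_def)
  next
    case (Add s1 s2) then show ?case by (cases t) (auto simp: enc_def)
  next
    case (Mult s1 s2) then show ?case by (cases t) (auto simp: enc_def)
  qed
  then show ?thesis by (auto simp: inj_def)
qed

lemma varietyD:
  fixes K :: "'u::infinite alg set" and I :: "'u set"
  assumes "variety K"
  shows variety_algebra: "A \<in> K \<Longrightarrow> algebra A"
    and variety_subalgebra: "A \<in> K \<Longrightarrow> subalgebra B A \<Longrightarrow> B \<in> K"
    and variety_homomorphic_image: "A \<in> K \<Longrightarrow> homomorphic_image B A \<Longrightarrow> B \<in> K"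
    and variety_product: "(\<And>i. i \<in> I \<Longrightarrow> F i \<in> K) \<Longrightarrow> subalgebra P (direct_product I F) \<Longrightarrow>
      algebra B \<Longrightarrow> isomorphic B P \<Longrightarrow> B \<in> K"
proof -
  note V = assms[unfolded variety_def]
  show "A \<in> K \<Longrightarrow> algebra A" using V[THEN conjunct1] by (rule bspec)
  show "A \<in> K \<Longrightarrow> subalgebra B A \<Longrightarrow> B \<in> K"
    using V[THEN conjunct2, THEN conjunct1] by (elim ballE allE impE) auto
  show "A \<in> K \<Longrightarrow> homomorphic_image B A \<Longrightarrow> B \<in> K"
    using V[THEN conjunct2, THEN conjunct2, THEN conjunct1] by (elim ballE allE impE) auto
  show "B \<in> K" if "\<And>i. i \<in> I \<Longrightarrow> F i \<in> K" "subalgebra P (direct_product I F)"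
    "algebra B" "isomorphic B P"
    using V[THEN conjunct2, THEN conjunct2, THEN conjunct2, rule_format, of I F P B] that by simp
qed

lemma variety_is_equational:
  fixes K :: "'u::infinite alg set"
  assumes K: "variety K"
  shows "K = models {(s, t). \<forall>A\<in>K. satisfies A s t}" (is "_ = models ?\<Sigma>")
proof
  show "K \<subseteq> models ?\<Sigma>" using variety_algebra[OF K] by (auto simp: models_def)
  show "models ?\<Sigma> \<subseteq> K"
  proof
    fix A :: "'u alg" assume "A \<in> models ?\<Sigma>"
    then have A: "algebra A" and sat: "\<And>s t. (s, t) \<in> ?\<Sigma> \<Longrightarrow> satisfies A s t"
      by (auto simp: models_def)
    obtain a0 where a0: "a0 \<in> carrier A" using A by (auto simp: algebra_def)
    define h where "h = (\<lambda>x. if x \<in> carrier A then x else a0)"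
    have h: "range h \<subseteq> carrier A" using a0 by (auto simp: h_def)
    define eqv where "eqv s t \<longleftrightarrow> (\<forall>B\<in>K. satisfies B s t)" for s t :: "'u trm"
    have eqvA: "eval A h s = eval A h t" if "eqv s t" for s t
    proof -
      let ?X = "set_trm s \<union> set_trm t"
      obtain g :: "'u \<Rightarrow> nat" where g: "inj_on g ?X"
        using finite_imp_inj_to_nat_seg[of ?X] finite_set_trm by (metis finite_Un)
      have "satisfies B (map_trm g s) (map_trm g t)" if "B \<in> K" for B
        unfolding satisfies_def
      proof (intro allI impI)
        fix \<rho> :: "nat \<Rightarrow> 'u" assume "range \<rho> \<subseteq> carrier B"
        then have "range (\<rho> \<circ> g) \<subseteq> carrier B" by auto
        then show "eval B \<rho> (map_trm g s) = eval B \<rho> (map_trm g t)"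
          using \<open>eqv s t\<close> \<open>B \<in> K\<close> by (simp add: eval_map_trm eqv_def satisfies_def)
      qed
      then have "satisfies A (map_trm g s) (map_trm g t)" by (intro sat) auto
      moreover have "range (h \<circ> inv_into ?X g) \<subseteq> carrier A" using h by auto
      ultimately have "eval A (h \<circ> inv_into ?X g \<circ> g) s = eval A (h \<circ> inv_into ?X g \<circ> g) t"
        by (simp add: satisfies_def eval_map_trm)
      moreover have "eval A (h \<circ> inv_into ?X g \<circ> g) s = eval A h s"
        by (rule eval_cong) (simp add: inv_into_f_f[OF g])
      moreover have "eval A (h \<circ> inv_into ?X g \<circ> g) t = eval A h t"
        by (rule eval_cong) (simp add: inv_into_f_f[OF g])
      ultimately show ?thesis by simp
    qed
    obtain enc :: "'u trm \<Rightarrow> 'u" where enc: "inj enc" using inj_trm_encoding by blast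
    text \<open>The index of a pair of terms is the code of their sum.\<close>
    define I where "I = {enc (Add s t) | s t. \<not> eqv s t}"
    have "\<forall>i\<in>I. \<exists>B \<rho> s t. i = enc (Add s t) \<and> B \<in> K \<and> range \<rho> \<subseteq> carrier B \<and>
        eval B \<rho> s \<noteq> eval B \<rho> t"
      by (fastforce simp: I_def eqv_def satisfies_def)
    then obtain B \<rho> s' t' where BR: "\<And>i. i \<in> I \<Longrightarrow> i = enc (Add (s' i) (t' i)) \<and> B i \<in> K \<and>
        range (\<rho> i) \<subseteq> carrier (B i) \<and> eval (B i) (\<rho> i) (s' i) \<noteq> eval (B i) (\<rho> i) (t' i)"
      by metis
    have BA: "algebra (B i)" if "i \<in> I" for i 
      using BR[OF that] by (intro variety_algebra[OF K]) simp
    define \<phi> where "\<phi> s = (\<lambda>i\<in>I. eval (B i) (\<rho> i) s)" for s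
    have \<phi>_iff: "\<phi> s = \<phi> t \<longleftrightarrow> eqv s t" for s t
    proof
      assume eq: "\<phi> s = \<phi> t"
      show "eqv s t"
      proof (rule ccontr)
        assume "\<not> eqv s t"
        then have i: "enc (Add s t) \<in> I" (is "?i \<in> I") by (auto simp: I_def)
        have "Add s t = Add (s' ?i) (t' ?i)" using BR[OF i] enc by (metis injD)
        then have "eval (B ?i) (\<rho> ?i) s \<noteq> eval (B ?i) (\<rho> ?i) t" using BR[OF i] by simp
        then show False using fun_cong[OF eq, of ?i] i by (simp add: \<phi>_def)
      qed
    next
      assume "eqv s t"
      then show "\<phi> s = \<phi> t" using BR
        unfolding \<phi>_def eqv_def satisfies_def by (intro restrict_ext) blast
    qed
    let ?D = "direct_product I B"
    have \<phi>D: "\<phi> s \<in> carrier ?D" for s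
      using BR BA by (auto simp: direct_product_def \<phi>_def intro!: eval_closed)
    have \<phi>_op: "add ?D (\<phi> s) (\<phi> t) = \<phi> (Add s t)" "mult ?D (\<phi> s) (\<phi> t) = \<phi> (Mult s t)" for s t
      by (auto simp: direct_product_def \<phi>_def)
    define P where "P = \<lparr>carrier = range \<phi>, mult = mult ?D, add = add ?D\<rparr>"
    have P: "subalgebra P ?D"
      using \<phi>D by (auto simp: P_def subalgebra_def algebra_def \<phi>_op)
    define rep where "rep c = (SOME s. \<phi> s = c)" for c
    have rep: "\<phi> (rep (\<phi> s)) = \<phi> s" for s unfolding rep_def by (rule someI) simp
    define dec where "dec x = \<phi> (inv enc x)" for x
    define cod where "cod c = enc (rep c)" for c
    have dec_cod [simp]: "dec (cod (\<phi> s)) = \<phi> s" for s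
      by (simp add: dec_def cod_def enc rep)
    define F where "F = \<lparr>carrier = cod ` range \<phi>, mult = (\<lambda>x y. cod (mult ?D (dec x) (dec y))),
        add = (\<lambda>x y. cod (add ?D (dec x) (dec y)))\<rparr>"
    have F: "algebra F" by (auto simp: F_def algebra_def \<phi>_op)
    have "dec \<in> hom F P" by (auto simp: hom_def F_def P_def \<phi>_op)
    moreover have "bij_betw dec (carrier F) (carrier P)"
      by (rule bij_betw_byWitness[where f' = cod]) (auto simp: F_def P_def)
    ultimately have "isomorphic F P" by (auto simp: isomorphic_def)
    then have FK: "F \<in> K" using BR by (intro variety_product[OF K _ P F]) auto
    define f where "f x = eval A h (inv enc x)" for x
    have f: "f (cod (\<phi> s)) = eval A h s" for s
    proof -
      have "eqv (rep (\<phi> s)) s" using rep \<phi>_iff by blast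
      then show ?thesis by (simp add: f_def cod_def enc eqvA)
    qed
    have "f \<in> hom F A"
      using eval_closed[OF A h] by (auto simp: hom_def F_def f \<phi>_op)
    moreover have "f ` carrier F = carrier A"
    proof
      show "f ` carrier F \<subseteq> carrier A" using eval_closed[OF A h] by (auto simp: F_def f)
      have "x = f (cod (\<phi> (Var x)))" if "x \<in> carrier A" for x using that by (simp add: f h_def)
      then show "carrier A \<subseteq> f ` carrier F" by (auto simp: F_def)
    qed
    ultimately have "homomorphic_image A F" using A by (auto simp: homomorphic_image_def)
    then show "A \<in> K" by (rule variety_homomorphic_image[OF K FK])
  qed
qed

theorem variety_iff_equational:
  fixes K :: "'u::infinite alg set"
  shows "variety K \<longleftrightarrow> (\<exists>\<Sigma>. K = models \<Sigma>)"
  using variety_is_equational variety_models by blast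

end

theory Submission
  imports Defs "HOL-Library.Countable"
begin

text \<open>
  Let \<open>S\<close> be an ai-semiring on the semigroup of nonempty subsets of a finite set \<open>\<Omega>\<close> under disjoint
  union, with zero. Whatever its addition is, the zero is absorbing for it, and the sum of two
  sets, if it is not the zero, contains both. Therefore every upward closed family of sets,
  together with the zero, is a subalgebra.

  For a finite graph \<open>E\<close> in which every edge lies in a triangle, let \<open>\<Omega>\<close> consist of the independent
  sets of \<open>E\<close> and represent a vertex by its star, the set of all independent sets containing it:
  two stars are disjoint iff the vertices are adjacent. Let \<open>t\<^sub>E\<close> be the sum of the
  monomials \<open>x\<^sub>u x\<^sub>v y\<^bsub>uv\<^esub>\<close> over all edges \<open>uv\<close>. With complements of unions
  of two adjacent stars as the values of the \<open>y\<^bsub>uv\<^esub>\<close>, all monomials take the value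
  \<open>\<Omega>\<close>, so that the identity \<open>t\<^sub>E \<approx> x\<^sup>2\<close> fails in the subalgebra of those sets
  that contain a star or such a complement. In this subalgebra, a nonzero value of \<open>t\<^sub>F\<close>
  yields a graph homomorphism from \<open>F\<close> to \<open>E\<close>, a complement being sent to the apex of a triangle
  over its edge. So an infinite antichain of such graphs in the homomorphism order gives infinitely
  many identities, each of which fails in a member of the variety that satisfies the others.
\<close>

section \<open>Semirings on the semigroups \<open>S_c\<close>\<close>

text \<open>The set of letters is arbitrary so that the independent sets of a graph can serve as
  letters. \<open>two_letters\<close> excludes the two-element semigroup, where the zero need not be
  absorbing for addition.\<close>

locale S_c_semiring =
  fixes S :: "'u alg" and \<Omega> :: "'b set" and a :: "'b set \<Rightarrow> 'u" and z :: 'u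
  assumes ai: "ai_semiring S"
    and carrier_eq: "carrier S = insert z (a ` {I. I \<subseteq> \<Omega> \<and> I \<noteq> {}})"
    and inj_a: "inj_on a {I. I \<subseteq> \<Omega> \<and> I \<noteq> {}}"
    and a_neq_z: "I \<subseteq> \<Omega> \<Longrightarrow> I \<noteq> {} \<Longrightarrow> a I \<noteq> z"
    and mult_a: "I \<subseteq> \<Omega> \<Longrightarrow> I \<noteq> {} \<Longrightarrow> J \<subseteq> \<Omega> \<Longrightarrow> J \<noteq> {} \<Longrightarrow>
      mult S (a I) (a J) = (if I \<inter> J = {} then a (I \<union> J) else z)"
    and mult_z: "x \<in> carrier S \<Longrightarrow> mult S x z = z" "x \<in> carrier S \<Longrightarrow> mult S z x = z"
    and two_letters: "\<exists>i\<in>\<Omega>. \<exists>j\<in>\<Omega>. i \<noteq> j"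
begin

lemma z_carrier: "z \<in> carrier S" and a_carrier: "I \<subseteq> \<Omega> \<Longrightarrow> I \<noteq> {} \<Longrightarrow> a I \<in> carrier S"
  by (auto simp: carrier_eq)

lemma carrier_cases:
  assumes "x \<in> carrier S"
  obtains "x = z" | I where "I \<subseteq> \<Omega>" "I \<noteq> {}" "x = a I"
  using assms by (auto simp: carrier_eq)

lemma add_carrier: "x \<in> carrier S \<Longrightarrow> y \<in> carrier S \<Longrightarrow> add S x y \<in> carrier S"
  and mult_carrier: "x \<in> carrier S \<Longrightarrow> y \<in> carrier S \<Longrightarrow> mult S x y \<in> carrier S"
  and add_comm: "x \<in> carrier S \<Longrightarrow> y \<in> carrier S \<Longrightarrow> add S x y = add S y x"
  and add_assoc: "x \<in> carrier S \<Longrightarrow> y \<in> carrier S \<Longrightarrow> w \<in> carrier S \<Longrightarrow>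
    add S (add S x y) w = add S x (add S y w)"
  and distrib: "x \<in> carrier S \<Longrightarrow> y \<in> carrier S \<Longrightarrow> w \<in> carrier S \<Longrightarrow>
    mult S (add S x y) w = add S (mult S x w) (mult S y w)"
  and add_idem: "x \<in> carrier S \<Longrightarrow> add S x x = x"
  using ai by (auto simp: ai_semiring_def semiring_def algebra_def)

lemma a_inject: "I \<subseteq> \<Omega> \<Longrightarrow> I \<noteq> {} \<Longrightarrow> J \<subseteq> \<Omega> \<Longrightarrow> J \<noteq> {} \<Longrightarrow> a I = a J \<Longrightarrow> I = J"
  using inj_a by (auto simp: inj_on_def)

lemma top_nonempty: "\<Omega> \<noteq> {}"
  using two_letters by auto

text \<open>A product equal to the full word determines the unknown factor. This is how sums are
  identified below.\<close>

lemma mult_eq_topD: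
  assumes x: "x \<in> carrier S" and J: "J \<subseteq> \<Omega>" "J \<noteq> {}" and eq: "mult S x (a J) = a \<Omega>"
  shows "\<exists>I. I \<noteq> {} \<and> x = a I \<and> I = \<Omega> - J"
  using x
proof (cases rule: carrier_cases)
  case 1
  then show ?thesis using eq mult_z(2)[OF a_carrier[OF J]] a_neq_z[of \<Omega>] top_nonempty by simp
next
  case (2 I)
  have "I \<inter> J = {}" "a (I \<union> J) = a \<Omega>"
    using eq 2 J mult_a[of I J] a_neq_z[of \<Omega>] top_nonempty by (auto split: if_splits)
  moreover from this have "I \<union> J = \<Omega>" using a_inject[of "I \<union> J" \<Omega>] 2 J top_nonempty by auto
  ultimately show ?thesis using 2 by blast
qed

section \<open>The addition of words and zero\<close>

text \<open>A nonzero sum other than the full word would survive multiplication by its complement,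
  which sends both summands to zero. A sum equal to the full word would make any two letters
  equal.\<close>

lemma add_z_top: "add S z (a \<Omega>) = z"
proof (rule ccontr)
  assume nz: "add S z (a \<Omega>) \<noteq> z"
  have c: "z \<in> carrier S" "a \<Omega> \<in> carrier S" using z_carrier a_carrier top_nonempty by auto
  have "add S z (a \<Omega>) \<in> carrier S" using c by (rule add_carrier)
  then obtain K where K: "K \<subseteq> \<Omega>" "K \<noteq> {}" "add S z (a \<Omega>) = a K"
    using nz by (cases rule: carrier_cases) auto
  have "K = \<Omega>"
  proof (rule ccontr)
    assume "K \<noteq> \<Omega>"
    define L where "L = \<Omega> - K"
    have L: "L \<subseteq> \<Omega>" "L \<noteq> {}" using K \<open>K \<noteq> \<Omega>\<close> by (auto simp: L_def)
    have "mult S (add S z (a \<Omega>)) (a L) = add S (mult S z (a L)) (mult S (a \<Omega>) (a L))"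
      using c a_carrier[OF L] by (intro distrib)
    also have "\<dots> = z"
      using mult_z(2)[OF a_carrier[OF L]] mult_a[of \<Omega> L] L top_nonempty add_idem[OF c(1)]
      by (auto simp: Int_absorb1)
    also have "mult S (add S z (a \<Omega>)) (a L) = a (K \<union> L)"
      using K L mult_a[of K L] by (auto simp: L_def)
    finally show False using a_neq_z[of "K \<union> L"] K L by auto
  qed
  then have zw: "add S z (a \<Omega>) = a \<Omega>" using K by simp
  obtain i j where ij: "i \<in> \<Omega>" "j \<in> \<Omega>" "i \<noteq> j" using two_letters by auto
  \<comment> \<open>Multiplying by the complement of \<open>{i}\<close> turns the summands into the
    full word and zero, whose sum is the full word by \<open>zw\<close>. Exchanging \<open>i\<close>
    and \<open>j\<close> then identifies the two letters.\<close>
  have *: "add S (a {i}) (a {j}) = a {i}" if ij: "i \<in> \<Omega>" "j \<in> \<Omega>" "i \<noteq> j" for i j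
  proof -
    have L: "\<Omega> - {i} \<subseteq> \<Omega>" "\<Omega> - {i} \<noteq> {}" using ij by auto
    have s: "a {i} \<in> carrier S" "a {j} \<in> carrier S" using ij by (auto intro!: a_carrier)
    have "mult S (add S (a {i}) (a {j})) (a (\<Omega> - {i}))
        = add S (mult S (a {i}) (a (\<Omega> - {i}))) (mult S (a {j}) (a (\<Omega> - {i})))"
      using s a_carrier[OF L] by (intro distrib)
    also have "\<dots> = add S (a \<Omega>) z"
      using mult_a[of "{i}" "\<Omega> - {i}"] mult_a[of "{j}" "\<Omega> - {i}"] ij L by (auto simp: insert_absorb)
    also have "\<dots> = a \<Omega>" using zw add_comm[OF c] by simp
    finally have "\<exists>I. I \<noteq> {} \<and> add S (a {i}) (a {j}) = a I \<and> I = \<Omega> - (\<Omega> - {i})"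
      using add_carrier[OF s] L by (intro mult_eq_topD)
    moreover have "\<Omega> - (\<Omega> - {i}) = {i}" using ij by auto
    ultimately show ?thesis by auto
  qed
  have "a {i} = a {j}"
    using *[of i j] *[of j i] ij add_comm[of "a {i}" "a {j}"] a_carrier[of "{i}"] a_carrier[of "{j}"] by auto
  then show False using a_inject[of "{i}" "{j}"] ij by auto
qed

lemma top_neq_z_add: "x \<in> carrier S \<Longrightarrow> a \<Omega> \<noteq> add S z x"
proof
  assume x: "x \<in> carrier S" and eq: "a \<Omega> = add S z x"
  have "add S z (a \<Omega>) = a \<Omega>"
    using add_assoc[OF z_carrier z_carrier x] add_idem[OF z_carrier] by (simp add: eq)
  then show False using add_z_top a_neq_z[of \<Omega>] top_nonempty by simp
qed

text \<open>If the sum is a word \<open>a J\<close>, multiplication by the complement of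
  \<open>J\<close> gives the full word, again as a sum of \<open>z\<close> and another element. The
  case \<open>J = \<Omega>\<close> is separate because its complement is empty and hence not a
  word.\<close>

lemma add_z: assumes x: "x \<in> carrier S" shows "add S z x = z"
  using add_carrier[OF z_carrier x]
proof (cases rule: carrier_cases)
  case (2 J)
  show ?thesis
  proof (cases "J = \<Omega>")
    case True
    then show ?thesis using top_neq_z_add[OF x] 2 by simp
  next
    case False
    then have L: "\<Omega> - J \<subseteq> \<Omega>" "\<Omega> - J \<noteq> {}" using 2 by auto
    have "a \<Omega> = mult S (add S z x) (a (\<Omega> - J))"
      using mult_a[of J "\<Omega> - J"] L 2 by (simp add: Un_absorb1)
    also have "\<dots> = add S z (mult S x (a (\<Omega> - J)))"
      using distrib[OF z_carrier x a_carrier[OF L]] mult_z(2)[OF a_carrier[OF L]] by simp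
    finally show ?thesis using top_neq_z_add[OF mult_carrier[OF x a_carrier[OF L]]] by simp
  qed
qed

lemma add_z_right: "x \<in> carrier S \<Longrightarrow> add S x z = z"
  using add_z add_comm z_carrier by simp

text \<open>If \<open>I\<close> met the complement of \<open>K\<close>, multiplying by that
  complement would send \<open>a I\<close> to zero and the sum to the full word.\<close>

lemma add_a_subset:
  assumes I: "I \<subseteq> \<Omega>" "I \<noteq> {}" and x: "x \<in> carrier S"
    and K: "K \<subseteq> \<Omega>" "K \<noteq> {}" and eq: "add S (a I) x = a K"
  shows "I \<subseteq> K"
proof (rule ccontr)
  assume "\<not> I \<subseteq> K"
  then have L: "\<Omega> - K \<subseteq> \<Omega>" "\<Omega> - K \<noteq> {}" and meet: "I \<inter> (\<Omega> - K) \<noteq> {}" using I by auto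
  have "a \<Omega> = mult S (add S (a I) x) (a (\<Omega> - K))"
    using mult_a[of K "\<Omega> - K"] L K eq by (simp add: Un_absorb1)
  also have "\<dots> = add S z (mult S x (a (\<Omega> - K)))"
    using distrib[OF a_carrier[OF I] x a_carrier[OF L]] mult_a[OF I L] meet by simp
  finally show False using top_neq_z_add[OF mult_carrier[OF x a_carrier[OF L]]] by simp
qed

end

section \<open>From multisets of letters to subsets of an index set\<close>

lemma subset_mset_set_iff:
  assumes "finite A"
  shows "u \<subseteq># mset_set A \<longleftrightarrow> (\<exists>B\<subseteq>A. u = mset_set B)"
proof
  assume u: "u \<subseteq># mset_set A"
  have "set_mset u \<subseteq> A" using set_mset_mono[OF u] assms by simp
  moreover have "u = mset_set (set_mset u)"
  proof (rule multiset_eqI)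
    fix x
    have "count u x \<le> 1" using mset_subset_eq_count[OF u, of x]
      by (auto simp: count_mset_set' split: if_splits)
    then show "count u x = count (mset_set (set_mset u)) x"
    proof (cases "x \<in># u")
      case True
      then have "count u x \<noteq> 0" by simp
      with \<open>count u x \<le> 1\<close> have "count u x = 1" by linarith
      then show ?thesis using True by simp
    qed (simp add: not_in_iff)
  qed
  ultimately show "\<exists>B\<subseteq>A. u = mset_set B" by blast
next
  assume "\<exists>B\<subseteq>A. u = mset_set B"
  then show "u \<subseteq># mset_set A" using assms by (auto simp: subset_imp_msubset_mset_set)
qed

lemma mset_set_add_subset_iff:
  assumes "finite A" "B \<subseteq> A" "C \<subseteq> A"
  shows "mset_set B + mset_set C \<subseteq># mset_set A \<longleftrightarrow> B \<inter> C = {}"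
proof -
  have fin: "finite B" "finite C" using assms finite_subset by auto
  show ?thesis
  proof
    assume le: "mset_set B + mset_set C \<subseteq># mset_set A"
    show "B \<inter> C = {}"
    proof (rule ccontr)
      assume "B \<inter> C \<noteq> {}"
      then obtain x where "x \<in> B" "x \<in> C" by auto
      then show False using mset_subset_eq_count[OF le, of x] assms fin
        by (auto simp: count_mset_set' split: if_splits)
    qed
  next
    assume "B \<inter> C = {}"
    then show "mset_set B + mset_set C \<subseteq># mset_set A"
      using assms fin by (simp flip: mset_set_Union add: subset_imp_msubset_mset_set)
  qed
qed

text \<open>The hypothesis is used for \<open>n = card \<Omega>\<close>; the bijection
  \<open>e\<close> from \<Omega> onto \<open>{1..n}\<close> renames the letters.\<close>

lemma S_c_semiring_exists:
  fixes V :: "'u alg set" and \<Omega> :: "'b set"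
  assumes V: "\<forall>S\<in>V. ai_semiring S"
    and ex: "\<forall>n::nat. n \<ge> 1 \<longrightarrow> (\<exists>S\<in>V. mult_isomorphic (mult_reduct S) (S_c (mset_set {1..n})))"
    and fin: "finite \<Omega>" and two: "\<exists>i\<in>\<Omega>. \<exists>j\<in>\<Omega>. i \<noteq> j"
  shows "\<exists>S\<in>V. \<exists>a z. S_c_semiring S \<Omega> a z"
proof -
  define N where "N = {1..card \<Omega>}"
  have finN [simp]: "finite N" by (simp add: N_def)
  have "card \<Omega> \<ge> 1" using two fin by (auto simp: Suc_le_eq card_gt_0_iff)
  then obtain S where S: "S \<in> V" "mult_isomorphic (mult_reduct S) (S_c (mset_set N))"
    using ex unfolding N_def by blast
  let ?C = "S_c (mset_set N)"
  have [simp]: "carrier (mult_reduct S) = carrier S" "mult (mult_reduct S) = mult S"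
    by (simp_all add: mult_reduct_def mult_struct.defs)
  obtain f where f: "bij_betw f (carrier S) (carrier ?C)"
    and fm: "\<And>x y. x \<in> carrier S \<Longrightarrow> y \<in> carrier S \<Longrightarrow> f (mult S x y) = mult ?C (f x) (f y)"
    using S(2) by (auto simp: mult_isomorphic_def)
  obtain e where e: "bij_betw e \<Omega> N"
    using finite_same_card_bij[OF fin finN] by (auto simp: N_def)
  define g where "g = inv_into (carrier S) f"
  have g: "bij_betw g (carrier ?C) (carrier S)" unfolding g_def by (rule bij_betw_inv_into[OF f])
  have gf: "g (f x) = x" if "x \<in> carrier S" for x
    unfolding g_def by (rule bij_betw_inv_into_left[OF f that])
  have fg: "f (g y) = y" if "y \<in> carrier ?C" for y
    unfolding g_def by (rule bij_betw_inv_into_right[OF f that])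
  have gc: "g y \<in> carrier S" if "y \<in> carrier ?C" for y using g that by (auto simp: bij_betw_def)
  have gi: "y = y'" if "y \<in> carrier ?C" "y' \<in> carrier ?C" "g y = g y'" for y y'
    using fg that by metis
  have ai: "algebra S" using V S(1) by (auto simp: ai_semiring_def semiring_def)
  have gm: "mult S (g y) (g y') = g (mult ?C y y')" if "y \<in> carrier ?C" "y' \<in> carrier ?C" for y y'
  proof -
    have "mult S (g y) (g y') \<in> carrier S" using ai gc that by (auto simp: algebra_def)
    from gf[OF this] show ?thesis using fm[of "g y" "g y'"] gc fg that by simp
  qed
  let ?P = "{I. I \<subseteq> \<Omega> \<and> I \<noteq> {}}"
  define t where "t I = Some (mset_set (e ` I))" for I
  have eI: "e ` I \<subseteq> N" if "I \<subseteq> \<Omega>" for I using e that by (auto simp: bij_betw_def)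
  have finI: "finite (e ` I)" if "I \<subseteq> \<Omega>" for I using fin that finite_subset by blast
  have e_inj: "e ` I = e ` J \<longleftrightarrow> I = J" if "I \<subseteq> \<Omega>" "J \<subseteq> \<Omega>" for I J
    using e that by (auto simp: bij_betw_def inj_on_image_eq_iff)
  have e_Int: "e ` I \<inter> e ` J = {} \<longleftrightarrow> I \<inter> J = {}" if "I \<subseteq> \<Omega>" "J \<subseteq> \<Omega>" for I J
    using inj_on_image_Int[of e \<Omega> I J] e that by (auto simp: bij_betw_def)
  have carC: "carrier ?C = insert None (t ` ?P)"
  proof -
    have "{u. u \<noteq> {#} \<and> u \<subseteq># mset_set N} = (\<lambda>I. mset_set (e ` I)) ` ?P"
    proof (intro equalityI subsetI)
      fix u assume "u \<in> {u. u \<noteq> {#} \<and> u \<subseteq># mset_set N}"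
      then have u: "u \<noteq> {#}" "\<exists>B\<subseteq>N. u = mset_set B" by (simp_all add: subset_mset_set_iff)
      then obtain B where B: "B \<subseteq> N" "u = mset_set B" by auto
      with u(1) have "B \<noteq> {}" by auto
      have "B \<subseteq> e ` \<Omega>" using B(1) e by (simp add: bij_betw_def)
      then obtain I where I: "I \<subseteq> \<Omega>" "B = e ` I" by (rule subset_imageE)
      show "u \<in> (\<lambda>I. mset_set (e ` I)) ` ?P" 
        unfolding B(2) I(2) using I \<open>B \<noteq> {}\<close> by (intro image_eqI) auto
    next
      fix u assume "u \<in> (\<lambda>I. mset_set (e ` I)) ` ?P"
      then obtain I where I: "I \<subseteq> \<Omega>" "I \<noteq> {}" "u = mset_set (e ` I)" by auto
      have "u \<subseteq># mset_set N"
        unfolding I(3) using eI[OF I(1)] by (intro subset_imp_msubset_mset_set) auto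
      moreover have "u \<noteq> {#}" using I finI[OF I(1)] by (simp add: mset_set_empty_iff)
      ultimately show "u \<in> {u. u \<noteq> {#} \<and> u \<subseteq># mset_set N}" by simp
    qed
    then show ?thesis by (simp add: S_c_def t_def image_image)
  qed
  have tC: "t I \<in> carrier ?C" if "I \<subseteq> \<Omega>" "I \<noteq> {}" for I using that by (auto simp: carC)
  have tm: "mult ?C (t I) (t J) = (if I \<inter> J = {} then t (I \<union> J) else None)"
    if "I \<subseteq> \<Omega>" "J \<subseteq> \<Omega>" for I J
    using mset_set_add_subset_iff[OF finN eI[OF that(1)] eI[OF that(2)]] e_Int[OF that] finI[OF that(1)] finI[OF that(2)]
    by (simp add: S_c_def t_def image_Un mset_set_Union)
  have "S_c_semiring S \<Omega> (g \<circ> t) (g None)"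
  proof
    show "ai_semiring S" using V S by blast
    show "carrier S = insert (g None) ((g \<circ> t) ` ?P)"
      using g by (simp add: bij_betw_def carC image_comp)
    show "inj_on (g \<circ> t) ?P"
    proof (rule inj_onI)
      fix I J assume I: "I \<in> ?P" and J: "J \<in> ?P" and eq: "(g \<circ> t) I = (g \<circ> t) J"
      have "t I = t J" using I J eq by (intro gi tC) auto
      then show "I = J" using I J finI e_inj by (auto simp: t_def mset_set_eq_iff)
    qed
    show "(g \<circ> t) I \<noteq> g None" if "I \<subseteq> \<Omega>" "I \<noteq> {}" for I
      using gi[OF tC[OF that], of None] by (auto simp: carC t_def)
    show "mult S ((g \<circ> t) I) ((g \<circ> t) J) = (if I \<inter> J = {} then (g \<circ> t) (I \<union> J) else g None)"
      if "I \<subseteq> \<Omega>" "I \<noteq> {}" "J \<subseteq> \<Omega>" "J \<noteq> {}" for I J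
      using gm[OF tC tC, of I J] tm[of I J] that by simp
    have None: "None \<in> carrier ?C" by (simp add: carC)
    have absorb: "mult ?C y None = None" "mult ?C None y = None" for y
      by (simp_all add: S_c_def split: option.split)
    have fC: "f x \<in> carrier ?C" if "x \<in> carrier S" for x using f that by (auto simp: bij_betw_def)
    show "mult S x (g None) = g None" "mult S (g None) x = g None" if "x \<in> carrier S" for x
      using gm[OF fC[OF that] None] gm[OF None fC[OF that]] by (simp_all add: gf[OF that] absorb)
    show "\<exists>i\<in>\<Omega>. \<exists>j\<in>\<Omega>. i \<noteq> j" by (rule two)
  qed
  then show ?thesis using S(1) by (intro bexI[of _ S] exI)
qed

section \<open>Identities from graphs\<close>

text \<open>The vertices are the elements of \<open>Domain E\<close>, so that none is
  isolated.\<close>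

locale triangle_graph =
  fixes E :: "('v \<times> 'v) set"
  assumes fin: "finite E" and nonempty: "E \<noteq> {}"
    and sym: "(u, v) \<in> E \<Longrightarrow> (v, u) \<in> E"
    and irrefl: "(v, v) \<notin> E"
    and triangle: "(u, v) \<in> E \<Longrightarrow> \<exists>t. (t, u) \<in> E \<and> (t, v) \<in> E"

section \<open>Stars, labels and terms of a graph\<close>

definition graph_hom :: "('v \<times> 'v) set \<Rightarrow> ('w \<times> 'w) set \<Rightarrow> ('v \<Rightarrow> 'w) \<Rightarrow> bool" where
  "graph_hom E F f \<longleftrightarrow> (\<forall>(u, v)\<in>E. (f u, f v) \<in> F)"

definition indep :: "('v \<times> 'v) set \<Rightarrow> 'v set set" where
  "indep E = {e. e \<subseteq> Domain E \<and> (\<forall>u\<in>e. \<forall>v\<in>e. (u, v) \<notin> E)}"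

definition star :: "('v \<times> 'v) set \<Rightarrow> 'v \<Rightarrow> 'v set set" where
  "star E v = {e \<in> indep E. v \<in> e}"

text \<open>The empty independent set lies in every \<open>costar E e\<close>, so two of these are never disjoint.\<close>

definition costar :: "('v \<times> 'v) set \<Rightarrow> 'v \<times> 'v \<Rightarrow> 'v set set" where
  "costar E = (\<lambda>(u, v). indep E - (star E u \<union> star E v))"

text \<open>The admissible images \<open>v\<close> of a variable with value \<open>a K\<close> when
  a homomorphism is read off from an assignment.\<close>

definition labelled :: "('v \<times> 'v) set \<Rightarrow> 'v set set \<Rightarrow> 'v \<Rightarrow> bool" where
  "labelled E K v \<longleftrightarrow> v \<in> Domain E \<and> star E v \<subseteq> K \<or>
     (\<exists>x y. (x, y) \<in> E \<and> (v, x) \<in> E \<and> (v, y) \<in> E \<and> costar E (x, y) \<subseteq> K)"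

text \<open>Both orientations of an edge contribute a monomial, each with its own third
  variable.\<close>

definition edge_trm :: "'v \<times> 'v \<Rightarrow> ('v + 'v \<times> 'v) trm" where
  "edge_trm = (\<lambda>(u, v). Mult (Mult (Var (Inl u)) (Var (Inl v))) (Var (Inr (u, v))))"

text \<open>The signature has no constant to start the fold from, so the head occurs twice, which is
  harmless by idempotence.\<close>

definition sum_trm :: "'v trm list \<Rightarrow> 'v trm" where
  "sum_trm ts = foldr Add ts (hd ts)"

text \<open>The order of the edges is immaterial: the sum is evaluated only when all monomials agree
  or one of them is zero.\<close>

definition graph_trm :: "('v \<times> 'v) set \<Rightarrow> ('v + 'v \<times> 'v) trm" where
  "graph_trm E = sum_trm (map edge_trm (SOME es. set es = E))"

text \<open>A term for the zero: no nonempty set is disjoint from itself, so every square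
  vanishes.\<close>

definition square_trm :: "'v trm" where
  "square_trm = Mult (Var undefined) (Var undefined)"

lemma labelled_mono: "labelled E K v \<Longrightarrow> K \<subseteq> K' \<Longrightarrow> labelled E K' v"
  unfolding labelled_def by (meson order_trans)

context triangle_graph
begin

lemma finite_indep: "finite (indep E)"
proof (rule finite_subset)
  show "indep E \<subseteq> Pow (Domain E)" by (auto simp: indep_def)
  show "finite (Pow (Domain E))" using fin by (simp add: finite_Domain)
qed

lemma empty_indep: "{} \<in> indep E"
  and singleton_indep: "v \<in> Domain E \<Longrightarrow> {v} \<in> indep E"
  using irrefl by (auto simp: indep_def)

text \<open>Vertices that are not adjacent, equal or distinct, have the common independent set
  \<open>{u, v}\<close>.\<close>

lemma star_disjoint_iff:
  assumes "u \<in> Domain E" "v \<in> Domain E"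
  shows "star E u \<inter> star E v = {} \<longleftrightarrow> (u, v) \<in> E"
proof
  assume "star E u \<inter> star E v = {}"
  then have "{u, v} \<notin> indep E" by (auto simp: star_def)
  then show "(u, v) \<in> E" using assms sym irrefl by (auto simp: indep_def)
qed (auto simp: star_def indep_def)

text \<open>Disjoint stars belong to adjacent vertices. The star of \<open>u\<close> contains
  \<open>{u}\<close>, so a costar disjoint from it belongs to an edge at \<open>u\<close>, and the
  apex over that edge is adjacent to \<open>u\<close>. Two costars share the empty set.\<close>

lemma labelled_disjoint:
  assumes "labelled E K u" "labelled E K' v" and disj: "K \<inter> K' = {}"
  shows "(u, v) \<in> E"
proof -
  have mixed: "u \<in> {x, y}" if "u \<in> Domain E" "star E u \<subseteq> K" "costar E (x, y) \<subseteq> K'" "K \<inter> K' = {}"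
    for u x y K K'
  proof -
    have "{u} \<in> star E u" using that singleton_indep by (simp add: star_def)
    then have "{u} \<notin> costar E (x, y)" using that by blast
    then show ?thesis using singleton_indep[OF that(1)] by (auto simp: costar_def star_def)
  qed
  have empty: "{} \<in> costar E xy" for xy
    using empty_indep by (auto simp: costar_def star_def)
  from assms(1) show ?thesis unfolding labelled_def
  proof (elim disjE exE conjE)
    assume u: "u \<in> Domain E" "star E u \<subseteq> K"
    from assms(2) show ?thesis unfolding labelled_def
    proof (elim disjE exE conjE)
      assume v: "v \<in> Domain E" "star E v \<subseteq> K'"
      have "star E u \<inter> star E v = {}" using u v disj by blast
      then show ?thesis using star_disjoint_iff u v by blast
    next
      fix x y assume v: "(v, x) \<in> E" "(v, y) \<in> E" "costar E (x, y) \<subseteq> K'"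
      show ?thesis using mixed[OF u v(3) disj] v sym by auto
    qed
  next
    fix x y assume u: "(u, x) \<in> E" "(u, y) \<in> E" "costar E (x, y) \<subseteq> K"
    from assms(2) show ?thesis unfolding labelled_def
    proof (elim disjE exE conjE)
      assume v: "v \<in> Domain E" "star E v \<subseteq> K'"
      show ?thesis using mixed[OF v u(3)] u disj by auto
    next
      fix x' y' assume v: "costar E (x', y') \<subseteq> K'"
      show ?thesis using empty[of "(x, y)"] empty[of "(x', y')"] u v disj by blast
    qed
  qed
qed

end

section \<open>Evaluation of terms and upward closed subalgebras\<close>

context S_c_semiring
begin

lemma eval_carrier: "range \<rho> \<subseteq> carrier S \<Longrightarrow> eval S \<rho> t \<in> carrier S"
  using ai by (intro eval_closed) (auto simp: ai_semiring_def semiring_def)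

lemma eval_sum_trm_z:
  assumes \<rho>: "range \<rho> \<subseteq> carrier S" and t: "t \<in> set ts" "eval S \<rho> t = z"
  shows "eval S \<rho> (sum_trm ts) = z"
proof -
  have "t \<in> set ts \<Longrightarrow> eval S \<rho> (foldr Add ts s) = z" for s
  proof (induction ts)
    case (Cons r ts)
    then show ?case using eval_carrier[OF \<rho>] by (cases "r = t") (auto simp: t(2) add_z add_z_right)
  qed simp
  then show ?thesis using t(1) by (simp add: sum_trm_def)
qed

lemma eval_sum_trm_const:
  assumes "w \<in> carrier S" "ts \<noteq> []" "\<And>t. t \<in> set ts \<Longrightarrow> eval S \<rho> t = w"
  shows "eval S \<rho> (sum_trm ts) = w"
proof -
  have "(\<And>t. t \<in> set ts \<Longrightarrow> eval S \<rho> t = w) \<Longrightarrow> eval S \<rho> s = w \<Longrightarrow> eval S \<rho> (foldr Add ts s) = w" for s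
    by (induction ts) (auto simp: add_idem assms(1))
  then show ?thesis using assms(2,3) by (simp add: sum_trm_def)
qed

lemma mult_a_neq_zD:
  assumes "x \<in> carrier S" "y \<in> carrier S" "mult S x y \<noteq> z"
  shows "\<exists>I J. I \<subseteq> \<Omega> \<and> I \<noteq> {} \<and> J \<subseteq> \<Omega> \<and> J \<noteq> {} \<and> x = a I \<and> y = a J \<and> I \<inter> J = {}"
proof (cases rule: carrier_cases[OF assms(1)])
  case 1
  then show ?thesis using assms mult_z by auto
next
  case x: (2 I)
  show ?thesis
  proof (cases rule: carrier_cases[OF assms(2)])
    case 1
    then show ?thesis using assms mult_z by auto
  next
    case (2 J)
    then show ?thesis using x assms(3) mult_a[of I J] by (metis (full_types))
  qed
qed

lemma square_z: "x \<in> carrier S \<Longrightarrow> mult S x x = z"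
  using mult_a_neq_zD[of x x] a_inject by (metis Int_absorb)

text \<open>A nonzero sum contains its summands, and a nonzero product is the union of its
  factors.\<close>

lemma subalgebra_upward_closed:
  assumes up: "\<And>K K'. Q K \<Longrightarrow> K \<subseteq> K' \<Longrightarrow> Q K'"
  shows "subalgebra (S\<lparr>carrier := insert z (a ` {K. K \<subseteq> \<Omega> \<and> K \<noteq> {} \<and> Q K})\<rparr>) S"
    (is "subalgebra (S\<lparr>carrier := ?C\<rparr>) S")
proof -
  have sub: "?C \<subseteq> carrier S" by (auto simp: carrier_eq)
  have "add S x y \<in> ?C \<and> mult S x y \<in> ?C" if xy: "x \<in> ?C" "y \<in> ?C" for x y
  proof
    have c: "x \<in> carrier S" "y \<in> carrier S" using xy sub by auto
    show "add S x y \<in> ?C"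
    proof (cases "x = z")
      case True
      then show ?thesis using add_z c by simp
    next
      case False
      then obtain I where I: "I \<subseteq> \<Omega>" "I \<noteq> {}" "Q I" "x = a I" using xy(1) by auto
      from add_carrier[OF c] show ?thesis
      proof (cases rule: carrier_cases)
        case (2 K)
        then have "I \<subseteq> K" using add_a_subset[OF I(1,2) c(2), of K] I(4) by simp
        then show ?thesis using 2 up[OF I(3)] by auto
      qed simp
    qed
    show "mult S x y \<in> ?C"
    proof (cases "mult S x y = z")
      case False
      then obtain I J where IJ: "I \<subseteq> \<Omega>" "I \<noteq> {}" "J \<subseteq> \<Omega>" "J \<noteq> {}" "x = a I" "y = a J" "I \<inter> J = {}"
        using mult_a_neq_zD[OF c] by blast
      have "x \<noteq> z" using IJ a_neq_z by simp
      then obtain I' where "I' \<subseteq> \<Omega>" "I' \<noteq> {}" "Q I'" "x = a I'" using xy(1) by auto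
      then have "Q I" using IJ a_inject by metis
      then have "Q (I \<union> J)" using up by blast
      then show ?thesis using IJ mult_a[of I J] by auto
    qed simp
  qed
  then show ?thesis using sub by (auto simp: subalgebra_def algebra_def)
qed

end

lemma eval_carrier_update [simp]: "eval (S\<lparr>carrier := C\<rparr>) \<rho> t = eval S \<rho> t"
  by (induction t) auto

lemma (in triangle_graph) set_edges: "set (SOME es. set es = E) = E"
  using finite_list[OF fin] by (rule someI_ex)

lemma graph_identity_separates:
  fixes S :: "'u alg" and E :: "('v \<times> 'v) set"
  assumes "triangle_graph E" and S: "S_c_semiring S (indep E) a z"
  shows "\<exists>A. subalgebra A S \<and> \<not> satisfies A (graph_trm E) square_trm \<and>
    (\<forall>F :: ('v \<times> 'v) set. triangle_graph F \<longrightarrow> (\<nexists>f. graph_hom F E f) \<longrightarrow>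
      satisfies A (graph_trm F) square_trm)"
proof -
  interpret E: triangle_graph E by fact
  interpret S: S_c_semiring S "indep E" a z by fact
  let ?\<Omega> = "indep E"
  let ?C = "insert z (a ` {K. K \<subseteq> ?\<Omega> \<and> K \<noteq> {} \<and> (\<exists>v. labelled E K v)})"
  define A where "A = S\<lparr>carrier := ?C\<rparr>"
  have A: "subalgebra A S" unfolding A_def
    by (rule S.subalgebra_upward_closed) (blast intro: labelled_mono)
  have carA: "carrier A = ?C" by (simp add: A_def)
  have evA [simp]: "eval A \<rho> t = eval S \<rho> t" for \<rho> :: "'w \<Rightarrow> 'u" and t by (simp add: A_def)
  have AS: "carrier A \<subseteq> carrier S" using A by (simp add: subalgebra_def)
  have sq: "eval S \<rho> square_trm = z" if "range \<rho> \<subseteq> carrier S" for \<rho> :: "'w \<Rightarrow> 'u"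
    using that by (auto simp: square_trm_def intro!: S.square_z)
  have "\<not> satisfies A (graph_trm E) square_trm"
  proof -
    \<comment> \<open>Each monomial then multiplies the parts of a partition of \<Omega>. The value
      \<open>z\<close> is a default for variables that do not come from \<open>E\<close>.\<close>
    define \<rho> where "\<rho> = case_sum (\<lambda>v. if v \<in> Domain E then a (star E v) else z)
      (\<lambda>e. if e \<in> E then a (costar E e) else z)"
    have star: "star E v \<subseteq> ?\<Omega>" "star E v \<noteq> {}" if "v \<in> Domain E" for v
      using E.singleton_indep[OF that] by (auto simp: star_def)
    have costar: "costar E e \<subseteq> ?\<Omega>" "costar E e \<noteq> {}" for e
      using E.empty_indep by (auto simp: costar_def star_def)
    have star_lab: "labelled E (star E v) v" if "v \<in> Domain E" for v using that by (simp add: labelled_def)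
    \<comment> \<open>Here the triangle over each edge is used: it gives the costars a label and so
      places them in the subalgebra.\<close>
    have cost: "\<exists>t. labelled E (costar E (u, v)) t" if "(u, v) \<in> E" for u v
      using E.triangle[OF that] that by (auto simp: labelled_def)
    have "a (star E v) \<in> carrier A" if "v \<in> Domain E" for v
      using star[OF that] star_lab[OF that] unfolding carA by blast
    moreover have "a (costar E e) \<in> carrier A" if "e \<in> E" for e
      using costar[of e] cost[of "fst e" "snd e"] that unfolding carA by auto
    moreover have "z \<in> carrier A" by (simp add: carA)
    ultimately have \<rho>: "range \<rho> \<subseteq> carrier A"
      by (auto simp: \<rho>_def split: sum.splits)
    have "eval S \<rho> (edge_trm (u, v)) = a ?\<Omega>" if uv: "(u, v) \<in> E" for u v
    proof -
      have D: "u \<in> Domain E" "v \<in> Domain E" using uv E.sym by auto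
      have "mult S (a (star E u)) (a (star E v)) = a (star E u \<union> star E v)"
        using S.mult_a[OF star[OF D(1)] star[OF D(2)]] E.star_disjoint_iff[OF D] uv by simp
      moreover have "mult S (a (star E u \<union> star E v)) (a (costar E (u, v))) =
          a (star E u \<union> star E v \<union> costar E (u, v))"
        using S.mult_a[OF _ _ costar, of "star E u \<union> star E v" "(u, v)"] star[OF D(1)] star[OF D(2)]
        by (auto simp: costar_def)
      moreover have "star E u \<union> star E v \<union> costar E (u, v) = ?\<Omega>"
        using star[OF D(1)] star[OF D(2)] by (auto simp: costar_def)
      ultimately show ?thesis using uv D by (simp add: edge_trm_def \<rho>_def)
    qed
    moreover have "map edge_trm (SOME es. set es = E) \<noteq> []"
      using E.set_edges E.nonempty by (metis list.set(1) map_is_Nil_conv)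
    ultimately have "eval S \<rho> (graph_trm E) = a ?\<Omega>"
      unfolding graph_trm_def using E.set_edges S.a_carrier[of ?\<Omega>] S.top_nonempty
      by (intro S.eval_sum_trm_const) auto
    moreover have "eval S \<rho> square_trm = z" using \<rho> AS by (intro sq) auto
    ultimately have "eval A \<rho> (graph_trm E) \<noteq> eval A \<rho> square_trm"
      using S.a_neq_z[of ?\<Omega>] S.top_nonempty by simp
    then show ?thesis using \<rho> unfolding satisfies_def by blast
  qed
  moreover have "satisfies A (graph_trm F) square_trm"
    if F: "triangle_graph F" and no_hom: "\<nexists>f. graph_hom F E f" for F :: "('v \<times> 'v) set"
    unfolding satisfies_def
  proof (intro allI impI)
    interpret F: triangle_graph F by fact
    fix \<rho> :: "'v + 'v \<times> 'v \<Rightarrow> 'u" assume \<rho>: "range \<rho> \<subseteq> carrier A"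
    have \<rho>A: "\<rho> x \<in> carrier A" for x using \<rho> by blast
    from \<rho> have \<rho>S: "range \<rho> \<subseteq> carrier S" using AS by auto
    \<comment> \<open>One zero monomial suffices, since zero is absorbing for addition.\<close>
    have "\<exists>u v. (u, v) \<in> F \<and> eval S \<rho> (edge_trm (u, v)) = z"
    proof (rule ccontr)
      assume "\<not> ?thesis"
      then have nz: "eval S \<rho> (edge_trm (u, v)) \<noteq> z" if "(u, v) \<in> F" for u v using that by blast
      have nz': "mult S (\<rho> (Inl u)) (\<rho> (Inl v)) \<noteq> z" if "(u, v) \<in> F" for u v
        using nz[OF that] \<rho>S S.mult_z by (auto simp: edge_trm_def)
      \<comment> \<open>Set and label are chosen for each vertex rather than for each edge, so that
        \<open>f\<close> is a map on vertices.\<close>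
      define K where "K u = (SOME K. K \<subseteq> ?\<Omega> \<and> K \<noteq> {} \<and> \<rho> (Inl u) = a K \<and> (\<exists>v. labelled E K v))" for u
      define f where "f u = (SOME v. labelled E (K u) v)" for u
      have K: "K u \<subseteq> ?\<Omega> \<and> K u \<noteq> {} \<and> \<rho> (Inl u) = a (K u) \<and> (\<exists>v. labelled E (K u) v)"
        if "(u, v) \<in> F" for u v
      proof -
        have "\<rho> (Inl v) \<in> carrier S" using \<rho>S by auto
        then have "\<rho> (Inl u) \<noteq> z" using nz'[OF that] S.mult_z(2) by metis
        then have "\<exists>K. K \<subseteq> ?\<Omega> \<and> K \<noteq> {} \<and> \<rho> (Inl u) = a K \<and> (\<exists>v. labelled E K v)"
          using \<rho>A[of "Inl u"] unfolding carA by blast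
        then show ?thesis unfolding K_def by (rule someI_ex)
      qed
      have lab: "labelled E (K u) (f u)" if "(u, v) \<in> F" for u v
        unfolding f_def using K[OF that] by (blast intro: someI_ex)
      have "(f u, f v) \<in> E" if uv: "(u, v) \<in> F" for u v
      proof (rule E.labelled_disjoint[OF lab[OF uv] lab[OF F.sym[OF uv]]])
        show "K u \<inter> K v = {}"
          using nz'[OF uv] K[OF uv] K[OF F.sym[OF uv]] S.mult_a[of "K u" "K v"] by (auto split: if_splits)
      qed
      then have "graph_hom F E f" by (auto simp: graph_hom_def)
      then show False using no_hom by blast
    qed
    then obtain u v where "(u, v) \<in> F" "eval S \<rho> (edge_trm (u, v)) = z" by blast
    then have "eval S \<rho> (graph_trm F) = z"
      unfolding graph_trm_def using F.set_edges \<rho>S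
      by (intro S.eval_sum_trm_z[where t = "edge_trm (u, v)"]) auto
    then show "eval A \<rho> (graph_trm F) = eval A \<rho> square_trm" using sq[OF \<rho>S] by simp
  qed
  ultimately show ?thesis using A by blast
qed

section \<open>Counting subvarieties\<close>

text \<open>This brings identities in the variables of a graph to variables in \<open>nat\<close>,
  as \<open>models\<close> requires.\<close>

lemma satisfies_map_trm:
  fixes A :: "'a alg" and s t :: "'v trm" and g :: "'v \<Rightarrow> 'w"
  assumes "inj g"
  shows "satisfies A (map_trm g s) (map_trm g t) \<longleftrightarrow> satisfies A s t"
proof
  assume st: "satisfies A (map_trm g s) (map_trm g t)"
  show "satisfies A s t" unfolding satisfies_def
  proof (intro allI impI)
    fix \<rho> :: "'v \<Rightarrow> 'a" assume "range \<rho> \<subseteq> carrier A"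
    then have "range (\<rho> \<circ> inv g) \<subseteq> carrier A" by auto
    moreover have "\<rho> \<circ> inv g \<circ> g = \<rho>" using assms by (simp add: fun_eq_iff)
    ultimately show "eval A \<rho> s = eval A \<rho> t"
      using st unfolding satisfies_def by (metis eval_map_trm)
  qed
next
  assume st: "satisfies A s t"
  show "satisfies A (map_trm g s) (map_trm g t)" unfolding satisfies_def
  proof (intro allI impI)
    fix \<rho> :: "'w \<Rightarrow> 'a" assume "range \<rho> \<subseteq> carrier A"
    then have "range (\<rho> \<circ> g) \<subseteq> carrier A" by auto
    then show "eval A \<rho> (map_trm g s) = eval A \<rho> (map_trm g t)"
      using st by (simp add: satisfies_def eval_map_trm)
  qed
qed

lemma variety_Int_models:
  assumes "variety V"
  shows "variety (V \<inter> models \<Sigma>)"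
proof -
  have "V \<inter> models \<Sigma> = models ({(s, t). \<forall>A\<in>V. satisfies A s t} \<union> \<Sigma>)"
    by (subst variety_is_equational[OF assms]) (auto simp: models_def)
  then show ?thesis using variety_models by simp
qed

text \<open>By Birkhoff's theorem a subvariety is determined by its identities over
  \<open>nat\<close>, of which there are only countably many.\<close>

lemma subvarieties_lepoll:
  fixes V :: "'u::infinite alg set"
  shows "subvarieties V \<lesssim> (UNIV :: nat set set)"
proof -
  obtain enc :: "nat trm \<Rightarrow> nat" where enc: "inj enc" using inj_trm_encoding by blast
  define c where "c = (\<lambda>(s, t). prod_encode (enc s, enc t))"
  have c: "inj c" using enc by (auto simp: inj_def c_def)
  define T where "T W = {(s :: nat trm, t). \<forall>A\<in>W. satisfies A s t}" for W :: "'u alg set"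
  have "inj_on (\<lambda>W. c ` T W) (subvarieties V)"
  proof (rule inj_onI)
    fix W W' assume W: "W \<in> subvarieties V" and W': "W' \<in> subvarieties V" and eq: "c ` T W = c ` T W'"
    have "T W = T W'" using eq c by (simp add: inj_image_eq_iff)
    moreover have "W = models (T W)" "W' = models (T W')"
      unfolding T_def using W W' by (auto simp: subvarieties_def intro!: variety_is_equational)
    ultimately show "W = W'" by metis
  qed
  then show ?thesis by (auto simp: lepoll_def)
qed

lemma lepoll_subvarieties:
  fixes V :: "'u::infinite alg set"
  assumes V: "variety V"
    and A: "\<And>k :: nat. A k \<in> V"
    and sat: "\<And>j k. satisfies (A k) (s j) (t j :: nat trm) \<longleftrightarrow> j \<noteq> k"
  shows "(UNIV :: nat set set) \<lesssim> subvarieties V"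
proof -
  \<comment> \<open>Only the identities with index outside \<open>X\<close> are imposed. As
    \<open>A k\<close> violates just the identity \<open>k\<close>, the members \<open>A k\<close>
    recover \<open>X\<close>.\<close>
  define W where "W X = V \<inter> models {(s j, t j) | j. j \<notin> X}" for X
  have "A k \<in> W X \<longleftrightarrow> k \<in> X" for k X
  proof -
    have "A k \<in> W X \<longleftrightarrow> (\<forall>j. j \<notin> X \<longrightarrow> satisfies (A k) (s j) (t j))"
      using A[of k] variety_algebra[OF V A[of k]] unfolding W_def models_def by blast
    then show ?thesis using sat by blast
  qed
  then have "inj W" by (intro injI) (metis subsetI subset_antisym)
  moreover have "range W \<subseteq> subvarieties V"
    using variety_Int_models[OF V] by (auto simp: W_def subvarieties_def)
  ultimately show ?thesis by (auto simp: lepoll_def)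
qed

lemma lepoll_subvarieties_if_antichain:
  fixes V :: "'u::infinite alg set" and G :: "nat \<Rightarrow> ('v::countable \<times> 'v) set"
  assumes V: "variety V" and ai: "\<forall>S\<in>V. ai_semiring S"
    and ex: "\<forall>n::nat. n \<ge> 1 \<longrightarrow> (\<exists>S\<in>V. mult_isomorphic (mult_reduct S) (S_c (mset_set {1..n})))"
    and G: "\<And>k. triangle_graph (G k)"
    and anti: "\<And>j k f. graph_hom (G j) (G k) f \<Longrightarrow> j = k"
  shows "(UNIV :: nat set set) \<lesssim> subvarieties V"
proof -
  have "\<exists>A\<in>V. \<forall>j. satisfies A (graph_trm (G j)) square_trm \<longleftrightarrow> j \<noteq> k" for k
  proof -
    interpret triangle_graph "G k" by (rule G)
    obtain u v where "(u, v) \<in> G k" using nonempty by auto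
    then have "{u} \<in> indep (G k)" by (auto intro: singleton_indep)
    \<comment> \<open>The empty set and a singleton are the two letters that the semiring must
      have.\<close>
    then have "\<exists>i\<in>indep (G k). \<exists>j\<in>indep (G k). i \<noteq> j" using empty_indep by blast
    then obtain S a z where S: "S \<in> V" "S_c_semiring S (indep (G k)) a z"
      using S_c_semiring_exists[OF ai ex finite_indep] by blast
    show ?thesis
      using graph_identity_separates[OF G S(2)] variety_subalgebra[OF V S(1)] G anti by metis
  qed
  then obtain A where A: "\<And>k. A k \<in> V"
    "\<And>j k. satisfies (A k) (graph_trm (G j)) square_trm \<longleftrightarrow> j \<noteq> k" by metis
  show ?thesis
  proof (rule lepoll_subvarieties[OF V A(1)])
    show "satisfies (A k) (map_trm to_nat (graph_trm (G j))) (map_trm to_nat (square_trm :: ('v + 'v \<times> 'v) trm)) \<longleftrightarrow> j \<noteq> k"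
      for j k by (simp add: satisfies_map_trm[OF inj_to_nat] A(2))
  qed
qed

section \<open>An infinite antichain of graphs\<close>

text \<open>
  The graph \<open>chain_graph n\<close> encodes a list colouring problem: it has a complete graph on four
  palette vertices, and an inner vertex \<open>v\<close> is adjacent to the palette vertices outside its list
  \<open>colours v\<close>. The inner vertices form two cycles of length \<open>3 n + 1\<close> that meet in \<open>X\<close>.
  Consecutive lists share exactly one colour, so that assigning \<open>s\<close> to \<open>X\<close> determines the colours
  along the cycle \<open>s\<close>, at whose end \<open>s\<close> is excluded for \<open>X\<close>. Hence there is no list colouring, and
  a homomorphism into \<open>chain_graph m\<close>, which must permute the palettes, cannot send any inner vertex
  to the palette. It is then injective on neighbourhoods, because the neighbours of an inner vertex
  have distinct lists, so it maps the cycles to walks without backtracking. This forces \<open>n = m\<close>.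
\<close>

datatype vertex = Pal nat | X | Y nat nat

instance vertex :: countable
  by countable_datatype

text \<open>The colour common to the vertices \<open>i\<close> and \<open>i + 1\<close> of the cycle
  \<open>s\<close>. It runs through \<open>s, 2, 3\<close> periodically, so for \<open>s < 2\<close>
  any three consecutive values are distinct.\<close>

definition col :: "nat \<Rightarrow> nat \<Rightarrow> nat" where
  "col s i = (if i mod 3 = 0 then s else Suc (i mod 3))"

fun colours :: "vertex \<Rightarrow> nat set" where
  "colours (Pal c) = {c}"
| "colours X = {0, 1}"
| "colours (Y s i) = {col s (i - 1), col s i}"

definition inner :: "nat \<Rightarrow> vertex set" where
  "inner n = insert X {Y s i | s i. s < 2 \<and> 1 \<le> i \<and> i \<le> 3 * n}"

text \<open>The cycle \<open>s\<close> as a closed walk \<open>cyc n s 0, \<dots>, cyc n s (3 * n + 1)\<close> from \<open>X\<close> to \<open>X\<close>.\<close>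

definition cyc :: "nat \<Rightarrow> nat \<Rightarrow> nat \<Rightarrow> vertex" where
  "cyc n s i = (if i = 0 \<or> i = 3 * n + 1 then X else Y s i)"

definition chain_graph :: "nat \<Rightarrow> (vertex \<times> vertex) set" where
  "chain_graph n = {(Pal c, Pal d) | c d. c < 4 \<and> d < 4 \<and> c \<noteq> d}
     \<union> {(Pal c, v) | c v. c < 4 \<and> v \<in> inner n \<and> c \<notin> colours v}
     \<union> {(v, Pal c) | c v. c < 4 \<and> v \<in> inner n \<and> c \<notin> colours v}
     \<union> {(cyc n s i, cyc n s (Suc i)) | s i. s < 2 \<and> i \<le> 3 * n}
     \<union> {(cyc n s (Suc i), cyc n s i) | s i. s < 2 \<and> i \<le> 3 * n}"

section \<open>Adjacency and colour lists in the chain graphs\<close>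

lemma Pal_inner [simp]: "Pal c \<notin> inner n" and X_inner [simp]: "X \<in> inner n"
  and Y_inner [simp]: "Y s i \<in> inner n \<longleftrightarrow> s < 2 \<and> 1 \<le> i \<and> i \<le> 3 * n"
  by (auto simp: inner_def)

lemma cyc_inner: "s < 2 \<Longrightarrow> i \<le> 3 * n + 1 \<Longrightarrow> cyc n s i \<in> inner n"
  by (auto simp: cyc_def)

lemma cyc_neq_Pal [simp]: "cyc n s i \<noteq> Pal c" "Pal c \<noteq> cyc n s i"
  by (auto simp: cyc_def)

lemma Pal_Pal_edge [simp]: "(Pal c, Pal d) \<in> chain_graph n \<longleftrightarrow> c < 4 \<and> d < 4 \<and> c \<noteq> d"
  by (auto simp: chain_graph_def)

lemma Pal_inner_edge: 
  assumes "v \<in> inner n"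
  shows "(Pal c, v) \<in> chain_graph n \<longleftrightarrow> c < 4 \<and> c \<notin> colours v"
    "(v, Pal c) \<in> chain_graph n \<longleftrightarrow> c < 4 \<and> c \<notin> colours v"
  using assms by (auto simp: chain_graph_def)

lemma inner_edge_iff:
  assumes "u \<in> inner n" "v \<in> inner n"
  shows "(u, v) \<in> chain_graph n \<longleftrightarrow> (\<exists>s i. s < 2 \<and> i \<le> 3 * n \<and>
    ((u, v) = (cyc n s i, cyc n s (Suc i)) \<or> (v, u) = (cyc n s i, cyc n s (Suc i))))"
  using assms by (auto simp: chain_graph_def)

lemma edge_vertices:
  assumes "(u, v) \<in> chain_graph n"
  shows "u \<in> Pal ` {..<4} \<union> inner n" "v \<in> Pal ` {..<4} \<union> inner n"
  using assms by (auto simp: chain_graph_def intro!: cyc_inner)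

lemma chain_graph_sym: "(u, v) \<in> chain_graph n \<Longrightarrow> (v, u) \<in> chain_graph n"
  unfolding chain_graph_def by blast

lemma col_less: "s < 2 \<Longrightarrow> col s i < 4"
  by (auto simp: col_def)

lemma col_Suc: "s < 2 \<Longrightarrow> col s (Suc i) \<noteq> col s i" "s < 2 \<Longrightarrow> col s (Suc (Suc i)) \<noteq> col s i"
  by (auto simp: col_def mod_Suc)

lemma finite_colours: "finite (colours v)"
  by (cases v) auto

lemma colours_inner:
  assumes "v \<in> inner n"
  shows "card (colours v) = 2" "colours v \<subseteq> {..<4}"
proof -
  show "card (colours v) = 2"
  proof (cases v)
    case (Y s i)
    then obtain j where "i = Suc j" "s < 2" using assms by (cases i) auto
    then show ?thesis using Y col_Suc(1)[of s j] by (simp add: card_2_iff)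
  qed (use assms in auto)
  show "colours v \<subseteq> {..<4}"
    using assms by (cases v) (auto intro: col_less)
qed

lemma col_mem_cyc: "s < 2 \<Longrightarrow> i \<le> 3 * n \<Longrightarrow> col s i \<in> colours (cyc n s i)"
  "s < 2 \<Longrightarrow> i \<le> 3 * n \<Longrightarrow> col s i \<in> colours (cyc n s (Suc i))"
  by (auto simp: cyc_def col_def less_2_cases_iff)

lemma colours_cyc_cases: 
  assumes "s < 2" "1 \<le> i" "i \<le> 3 * n"
  shows "colours (cyc n s i) = {col s (i - 1), col s i}"
  using assms by (auto simp: cyc_def)

text \<open>The lists next to \<open>X\<close> are \<open>{s, 2}\<close> and \<open>{3, s}\<close>,
  which meet \<open>{0, 1}\<close> in \<open>s\<close>. Elsewhere three consecutive colours are
  distinct.\<close>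

lemma colours_cyc_disjoint:
  assumes "s < 2" "i \<le> 3 * n" "n > 0"
  shows "colours (cyc n s i) \<inter> colours (cyc n s (Suc i)) = {col s i}"
proof -
  consider "i = 0" "n > 0" | j where "i = Suc j" "i < 3 * n" | "i = 3 * n" "n > 0"
    using assms by (cases i) fastforce+
  then show ?thesis
  proof cases
    case 2
    then show ?thesis using assms(1) col_Suc[of s j] col_Suc(1)[of s "Suc j"] by (auto simp: cyc_def)
  qed (use assms in \<open>auto simp: cyc_def col_def less_2_cases_iff mod_Suc\<close>)
qed

lemma cyc_edge:
  "s < 2 \<Longrightarrow> i \<le> 3 * n \<Longrightarrow> (cyc n s i, cyc n s (Suc i)) \<in> chain_graph n"
  unfolding chain_graph_def by blast

lemma X_Y_edge:
  assumes "Y s i \<in> inner n"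
  shows "(X, Y s i) \<in> chain_graph n \<longleftrightarrow> i = 1 \<or> i = 3 * n"
    "(Y s i, X) \<in> chain_graph n \<longleftrightarrow> i = 1 \<or> i = 3 * n"
proof -
  show iff: "(X, Y s i) \<in> chain_graph n \<longleftrightarrow> i = 1 \<or> i = 3 * n"
  proof
    assume "(X, Y s i) \<in> chain_graph n"
    then show "i = 1 \<or> i = 3 * n"
      using assms inner_edge_iff[of X n "Y s i"] by (auto simp: cyc_def split: if_splits)
  next
    assume "i = 1 \<or> i = 3 * n"
    then show "(X, Y s i) \<in> chain_graph n"
    proof
      assume "i = 1"
      then show ?thesis using cyc_edge[of s 0 n] assms by (auto simp: cyc_def)
    next
      assume "i = 3 * n"
      then show ?thesis using cyc_edge[of s i n, THEN chain_graph_sym] assms by (auto simp: cyc_def)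
    qed
  qed
  show "(Y s i, X) \<in> chain_graph n \<longleftrightarrow> i = 1 \<or> i = 3 * n"
    using iff chain_graph_sym by blast
qed

lemma Y_Y_edge:
  assumes "Y s i \<in> inner n" "Y t j \<in> inner n"
  shows "(Y s i, Y t j) \<in> chain_graph n \<longleftrightarrow> s = t \<and> (i = Suc j \<or> j = Suc i)"
proof
  assume "(Y s i, Y t j) \<in> chain_graph n"
  then show "s = t \<and> (i = Suc j \<or> j = Suc i)"
    using assms inner_edge_iff[of "Y s i" n "Y t j"] by (auto simp: cyc_def split: if_splits)
next
  assume st: "s = t \<and> (i = Suc j \<or> j = Suc i)"
  then show "(Y s i, Y t j) \<in> chain_graph n"
    using cyc_edge[of s i n] cyc_edge[of s j n, THEN chain_graph_sym] assms by (auto simp: cyc_def)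
qed

lemma X_X_edge: "n > 0 \<Longrightarrow> (X, X) \<notin> chain_graph n"
  by (subst inner_edge_iff) (auto simp: cyc_def split: if_splits)

lemma inner_cases:
  assumes "v \<in> inner n"
  obtains "v = X" | s i where "v = Y s i" "s < 2" "1 \<le> i" "i \<le> 3 * n"
  using assms by (auto simp: inner_def)

lemma inner_irrefl: "n > 0 \<Longrightarrow> v \<in> inner n \<Longrightarrow> (v, v) \<notin> chain_graph n"
  by (elim inner_cases) (simp_all add: X_X_edge Y_Y_edge)

text \<open>Both cycles have length \<open>3 * n + 1\<close>, at least 4, and they share only
  \<open>X\<close>.\<close>

lemma inner_triangle_free:
  assumes "n > 0" "u \<in> inner n" "v \<in> inner n" "w \<in> inner n"
    and "(u, v) \<in> chain_graph n" "(v, w) \<in> chain_graph n" "(u, w) \<in> chain_graph n"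
  shows False
  by (rule inner_cases[OF assms(2)]; rule inner_cases[OF assms(3)]; rule inner_cases[OF assms(4)];
      use assms in \<open>auto simp: X_X_edge X_Y_edge Y_Y_edge\<close>; presburger)

lemma Y_neighbours:
  assumes "Y s i \<in> inner n" "v \<in> inner n" "(Y s i, v) \<in> chain_graph n"
  shows "v = cyc n s (i - 1) \<or> v = cyc n s (Suc i)"
  using assms(2)
proof (cases rule: inner_cases)
  case 1
  then show ?thesis using assms by (auto simp: X_Y_edge cyc_def)
next
  case (2 t j)
  then show ?thesis using assms by (auto simp: Y_Y_edge cyc_def)
qed

lemma colours_edge:
  assumes "n > 0" "u \<in> inner n" "v \<in> inner n" "(u, v) \<in> chain_graph n"
  shows "card (colours u \<union> colours v) = 3"
proof -
  obtain s i where si: "s < 2" "i \<le> 3 * n"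
    "(u, v) = (cyc n s i, cyc n s (Suc i)) \<or> (v, u) = (cyc n s i, cyc n s (Suc i))"
    using assms inner_edge_iff by blast
  then have "colours u \<inter> colours v = {col s i}"
    using colours_cyc_disjoint[OF si(1,2) assms(1)] by (auto simp: Int_commute)
  then have "card (colours u \<inter> colours v) = 1" by simp
  then show ?thesis
    using card_Un_Int[OF finite_colours finite_colours, of u v] colours_inner(1)[OF assms(2)] colours_inner(1)[OF assms(3)]
    by simp
qed

text \<open>The colour \<open>col s i\<close> is gone two steps later; at the end of the cycle it is
  3, which is not in the list of \<open>X\<close>. This prevents the image of a cycle from
  backtracking.\<close>

lemma colours_cyc_neq:
  assumes "s < 2" "Suc i \<le> 3 * n"
  shows "colours (cyc n s i) \<noteq> colours (cyc n s (Suc (Suc i)))"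
proof -
  have "col s i \<notin> colours (cyc n s (Suc (Suc i)))"
  proof (cases "Suc i = 3 * n")
    case True
    then have "i mod 3 = 2" by presburger
    then show ?thesis using True by (simp add: cyc_def col_def)
  next
    case False
    then show ?thesis using assms col_Suc[of s i] by (auto simp: cyc_def)
  qed
  moreover have "col s i \<in> colours (cyc n s i)" using assms by (intro col_mem_cyc) auto
  ultimately show ?thesis by blast
qed

section \<open>Complete subgraphs, triangles and loops\<close>

lemma ex_colour: "card A \<le> 3 \<Longrightarrow> finite A \<Longrightarrow> \<exists>c<4. c \<notin> (A :: nat set)"
  using card_mono[of A "{..<4}"] by fastforce

text \<open>Three palette neighbours would leave \<open>a\<close> one colour. Two of them, shared
  with an inner neighbour, would leave two colours for a union of lists of size 3. Otherwise there
  is an inner triangle.\<close>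

lemma inner_not_in_K4:
  assumes n: "n > 0" and a: "a \<in> inner n"
    and e: "(a, b) \<in> chain_graph n" "(a, c) \<in> chain_graph n" "(a, d) \<in> chain_graph n"
      "(b, c) \<in> chain_graph n" "(b, d) \<in> chain_graph n" "(c, d) \<in> chain_graph n"
  shows False
proof -
  have two: False if v: "v \<in> inner n" "(a, v) \<in> chain_graph n"
    and "(a, Pal x) \<in> chain_graph n" "(v, Pal x) \<in> chain_graph n"
      "(a, Pal y) \<in> chain_graph n" "(v, Pal y) \<in> chain_graph n" "x \<noteq> y" for v x y
  proof -
    have "colours a \<union> colours v \<subseteq> {..<4} - {x, y}" "{x, y} \<subseteq> {..<4}"
      using that a colours_inner(2) by (auto simp: Pal_inner_edge)
    then have "card (colours a \<union> colours v) \<le> card ({..<4} - {x, y})" by (intro card_mono) auto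
    also have "\<dots> = 2" using \<open>{x, y} \<subseteq> {..<4}\<close> \<open>x \<noteq> y\<close> by (subst card_Diff_subset) auto
    finally show False using colours_edge[OF n a v] by simp
  qed
  have one: False if "(a, Pal x) \<in> chain_graph n" "(a, Pal y) \<in> chain_graph n" "(a, Pal w) \<in> chain_graph n"
    "x \<noteq> y" "x \<noteq> w" "y \<noteq> w" for x y w
  proof -
    have "colours a \<subseteq> {..<4} - {x, y, w}" "{x, y, w} \<subseteq> {..<4}"
      using that a colours_inner(2) by (auto simp: Pal_inner_edge)
    then have "card (colours a) \<le> card ({..<4} - {x, y, w})" by (intro card_mono) auto
    also have "\<dots> = 1" using \<open>{x, y, w} \<subseteq> {..<4}\<close> that by (subst card_Diff_subset) auto
    finally show False using colours_inner(1)[OF a] by simp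
  qed
  have P: "v \<in> inner n \<or> (\<exists>x. v = Pal x)" if "(a, v) \<in> chain_graph n" for v
    using edge_vertices(2)[OF that] by auto
  note tri = inner_triangle_free[OF n a]
  note s = e(4-6)[THEN chain_graph_sym]
  from P[OF e(1)] P[OF e(2)] P[OF e(3)] show False
  proof (elim disjE exE)
    fix x y w assume "b = Pal x" "c = Pal y" "d = Pal w"
    then show False using one e by auto
  next
    fix x y assume "b = Pal x" "c = Pal y" "d \<in> inner n"
    then show False using two[of d x y] e s by auto
  next
    fix x y assume "b = Pal x" "d = Pal y" "c \<in> inner n"
    then show False using two[of c x y] e s by auto
  next
    fix x y assume "c = Pal x" "d = Pal y" "b \<in> inner n"
    then show False using two[of b x y] e s by auto
  qed (use tri e in blast)+
qed

text \<open>The ends of an edge involve at most three colours, and the palette vertex of a remaining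
  colour is adjacent to both.\<close>

lemma triangle_graph_chain:
  assumes n: "n > 0"
  shows "triangle_graph (chain_graph n)"
proof
  have "finite (inner n)"
  proof (rule finite_subset)
    show "inner n \<subseteq> insert X (case_prod Y ` ({..<2} \<times> {..3 * n}))" by (auto simp: inner_def)
  qed auto
  then have "finite ((Pal ` {..<4} \<union> inner n) \<times> (Pal ` {..<4} \<union> inner n))" by simp
  then show "finite (chain_graph n)"
    by (rule finite_subset[rotated]) (use edge_vertices in fast)
  have "(Pal 0, Pal 1) \<in> chain_graph n" by simp
  then show "chain_graph n \<noteq> {}" by blast
  show "(v, u) \<in> chain_graph n" if "(u, v) \<in> chain_graph n" for u v
    using that by (rule chain_graph_sym)
  show "(v, v) \<notin> chain_graph n" for v
    using edge_vertices(1)[of v v n] inner_irrefl[OF n] by auto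
  have PI: "\<exists>t. (t, Pal c) \<in> chain_graph n \<and> (t, v) \<in> chain_graph n"
    if "v \<in> inner n" "(Pal c, v) \<in> chain_graph n" for c v
  proof -
    have "card (insert c (colours v)) \<le> 3" using colours_inner(1)[OF that(1)] finite_colours by (simp add: card_insert_if)
    then obtain d where "d < 4" "d \<notin> insert c (colours v)" using ex_colour finite_colours by (metis finite_insert)
    then show ?thesis using that by (intro exI[of _ "Pal d"]) (simp add: Pal_inner_edge)
  qed
  fix u v assume uv: "(u, v) \<in> chain_graph n"
  consider c d where "u = Pal c" "v = Pal d" | c where "u = Pal c" "v \<in> inner n"
    | c where "v = Pal c" "u \<in> inner n" | "u \<in> inner n" "v \<in> inner n"
    using edge_vertices[OF uv] by auto
  then show "\<exists>t. (t, u) \<in> chain_graph n \<and> (t, v) \<in> chain_graph n"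
  proof cases
    case 1
    have "card {c, d} \<le> 3" by (simp add: card_insert_if)
    then obtain e where "e < 4" "e \<notin> {c, d}" using ex_colour[of "{c, d}"] by blast
    then show ?thesis using uv 1 by (intro exI[of _ "Pal e"]) simp
  next
    case 2
    then show ?thesis using PI uv by blast
  next
    case 3
    then show ?thesis using PI[of u c] chain_graph_sym[OF uv] by blast
  next
    case 4
    obtain d where "d < 4" "d \<notin> colours u \<union> colours v"
      using colours_edge[OF n 4 uv] ex_colour[of "colours u \<union> colours v"] finite_colours by auto
    then show ?thesis using 4 by (intro exI[of _ "Pal d"]) (simp add: Pal_inner_edge)
  qed
qed

text \<open>The walk \<open>h\<close> goes once around the loop at \<open>X\<close> that starts
  towards \<open>u\<close>, forwards or backwards. A walk that begins with \<open>X\<close>,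
  \<open>u\<close> and never backtracks has to follow it.\<close>

lemma loop_walk:
  assumes "m > 0" "u \<in> inner m" "(X, u) \<in> chain_graph m"
  shows "\<exists>h. h 0 = X \<and> h (Suc 0) = u \<and> h (3 * m + 1) = X \<and> (\<forall>i. 1 \<le> i \<and> i \<le> 3 * m \<longrightarrow> h i \<noteq> X) \<and>
    (\<forall>i v. i < 3 * m \<longrightarrow> v \<in> inner m \<longrightarrow> (h (Suc i), v) \<in> chain_graph m \<longrightarrow> v = h i \<or> v = h (Suc (Suc i)))"
proof -
  obtain s i where u: "u = Y s i" "s < 2" "1 \<le> i" "i \<le> 3 * m"
    by (rule inner_cases[OF assms(2)]) (use assms in \<open>auto simp: X_X_edge\<close>)
  have nb: "v = cyc m s (j - 1) \<or> v = cyc m s (Suc j)"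
    if "v \<in> inner m" "(cyc m s j, v) \<in> chain_graph m" "1 \<le> j" "j \<le> 3 * m" for v j
    using that Y_neighbours[of s j m v] u by (auto simp: cyc_def)
  have "i = 1 \<or> i = 3 * m" using u assms by (simp add: X_Y_edge)
  then show ?thesis
  proof
    assume "i = 1"
    let ?h = "cyc m s"
    have "v = ?h j \<or> v = ?h (Suc (Suc j))"
      if "j < 3 * m" "v \<in> inner m" "(?h (Suc j), v) \<in> chain_graph m" for j v
      using nb[of v "Suc j"] that by simp
    moreover have "?h 0 = X" "?h (Suc 0) = u" "?h (3 * m + 1) = X" using u \<open>i = 1\<close> by (auto simp: cyc_def)
    moreover have "?h j \<noteq> X" if "1 \<le> j \<and> j \<le> 3 * m" for j using that by (auto simp: cyc_def)
    ultimately show ?thesis by (intro exI[of _ ?h]) blast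
  next
    assume i: "i = 3 * m"
    let ?h = "\<lambda>j. cyc m s (3 * m + 1 - j)"
    have "v = ?h j \<or> v = ?h (Suc (Suc j))"
      if "j < 3 * m" "v \<in> inner m" "(?h (Suc j), v) \<in> chain_graph m" for j v
      using nb[of v "3 * m - j"] that by (auto simp: Suc_diff_le)
    moreover have "?h 0 = X" "?h (Suc 0) = u" "?h (3 * m + 1) = X" using u i by (auto simp: cyc_def)
    moreover have "?h j \<noteq> X" if "1 \<le> j \<and> j \<le> 3 * m" for j using that by (auto simp: cyc_def)
    ultimately show ?thesis by (intro exI[of _ ?h]) blast
  qed
qed

section \<open>Homomorphisms between chain graphs\<close>

locale chain_hom =
  fixes n m :: nat and f :: "vertex \<Rightarrow> vertex"
  assumes n: "n > 0" and m: "m > 0"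
    and hom: "graph_hom (chain_graph n) (chain_graph m) f"
begin

lemma f_edge: "(u, v) \<in> chain_graph n \<Longrightarrow> (f u, f v) \<in> chain_graph m"
  using hom by (auto simp: graph_hom_def)

text \<open>The four palette vertices form a complete graph, whose image contains no inner
  vertex.\<close>

lemma f_Pal: "c < 4 \<Longrightarrow> \<exists>d<4. f (Pal c) = Pal d"
proof -
  assume c: "c < 4"
  have "c = 0 \<or> c = 1 \<or> c = 2 \<or> c = 3" using c by linarith
  then have "distinct [c, (c + 1) mod 4, (c + 2) mod 4, (c + 3) mod 4]" by auto
  then obtain x y w where xyw: "distinct [c, x, y, w]" "x < 4" "y < 4" "w < 4"
    by (rule that) simp_all
  have "f (Pal c) \<notin> inner m"
  proof
    assume "f (Pal c) \<in> inner m"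
    from inner_not_in_K4[OF m this, of "f (Pal x)" "f (Pal y)" "f (Pal w)"] show False
      using c xyw by (simp add: f_edge)
  qed
  moreover have "(f (Pal c), f (Pal x)) \<in> chain_graph m" using c xyw by (intro f_edge) simp
  ultimately show ?thesis using edge_vertices(1) by fastforce
qed

definition p :: "nat \<Rightarrow> nat" where
  "p c = (SOME d. d < 4 \<and> f (Pal c) = Pal d)"

lemma p: "c < 4 \<Longrightarrow> p c < 4" "c < 4 \<Longrightarrow> f (Pal c) = Pal (p c)"
  unfolding p_def using someI_ex[OF f_Pal[of c]] by blast+

lemma p_inj: "c < 4 \<Longrightarrow> d < 4 \<Longrightarrow> p c = p d \<longleftrightarrow> c = d"
  using f_edge[of "Pal c" "Pal d"] p[of c] p[of d] by auto

lemma p_inj_on: "inj_on p {..<4}"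
  by (auto simp: inj_on_def p_inj)

lemma p_surj: "d < 4 \<Longrightarrow> \<exists>c<4. d = p c"
proof -
  have "p ` {..<4} \<subseteq> {..<4}" using p(1) by auto
  then have "p ` {..<4} = {..<4}" by (intro endo_inj_surj p_inj_on) auto
  then show "d < 4 \<Longrightarrow> \<exists>c<4. d = p c" by (metis imageE lessThan_iff)
qed

text \<open>The image of \<open>v\<close> is adjacent to \<open>Pal (p c)\<close> for each
  \<open>c\<close> outside the list of \<open>v\<close>. This bounds the list of an inner image,
  with equality by size, and confines a palette image to colours from the list.\<close>

lemma f_inner_cases:
  assumes v: "v \<in> inner n"
  obtains "f v \<in> inner m" "colours (f v) = p ` colours v"
  | c where "c \<in> colours v" "f v = Pal (p c)"
proof -
  obtain c where "c < 4" "c \<notin> colours v"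
    using ex_colour[OF _ finite_colours[of v]] colours_inner(1)[OF v] by auto
  then have "(v, Pal c) \<in> chain_graph n" using v by (simp add: Pal_inner_edge)
  from edge_vertices(1)[OF f_edge[OF this]] consider "f v \<in> inner m" | d where "d < 4" "f v = Pal d"
    by auto
  then show thesis
  proof cases
    case 1
    have "colours (f v) \<subseteq> p ` colours v"
    proof
      fix d assume d: "d \<in> colours (f v)"
      then have "d < 4" using colours_inner(2)[OF 1] by auto
      then obtain c where c: "c < 4" "d = p c" using p_surj by blast
      have "c \<in> colours v"
      proof (rule ccontr)
        assume "c \<notin> colours v"
        then have "(Pal (p c), f v) \<in> chain_graph m"
          using f_edge[of "Pal c" v] v c p by (simp add: Pal_inner_edge)
        then show False using d c 1 by (simp add: Pal_inner_edge)
      qed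
      then show "d \<in> p ` colours v" using c by blast
    qed
    moreover have "finite (p ` colours v)" using finite_colours by auto
    moreover have "card (p ` colours v) = card (colours (f v))"
      using card_image[OF inj_on_subset[OF p_inj_on colours_inner(2)[OF v]]]
        colours_inner(1)[OF v] colours_inner(1)[OF 1] by simp
    ultimately have "colours (f v) = p ` colours v" using card_subset_eq by metis
    then show thesis using that 1 by blast
  next
    case 2
    then obtain c where c: "c < 4" "d = p c" using p_surj by blast
    have "c \<in> colours v"
    proof (rule ccontr)
      assume "c \<notin> colours v"
      then have "(Pal (p c), f v) \<in> chain_graph m"
        using f_edge[of "Pal c" v] v c p by (simp add: Pal_inner_edge)
      then show False using 2 c by simp
    qed
    then show thesis using that 2 c by blast
  qed
qed

text \<open>The next vertex cannot receive the shared colour, nor an inner image, whose list would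
  contain that colour.\<close>

lemma f_cyc_Pal_step:
  assumes s: "s < 2" and i: "i \<le> 3 * n" and fi: "f (cyc n s i) = Pal (p (col s i))"
  shows "\<exists>c. c \<in> colours (cyc n s (Suc i)) \<and> c \<noteq> col s i \<and> f (cyc n s (Suc i)) = Pal (p c)"
proof -
  let ?v = "cyc n s (Suc i)"
  have v: "?v \<in> inner n" using s i by (intro cyc_inner) auto
  have e: "(Pal (p (col s i)), f ?v) \<in> chain_graph m" using f_edge[OF cyc_edge[OF s i]] fi by simp
  from v show ?thesis
  proof (cases rule: f_inner_cases)
    case 1
    then have "p (col s i) \<in> colours (f ?v)" using col_mem_cyc(2)[OF s i] by auto
    then show ?thesis using e 1 by (simp add: Pal_inner_edge)
  next
    case (2 c)
    then show ?thesis using e by auto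
  qed
qed

text \<open>The colour left for the next vertex is the one it shares with its own successor, so the
  situation repeats.\<close>

lemma f_cyc_Pal_chain:
  assumes s: "s < 2" and ij: "i \<le> j" and fi: "f (cyc n s i) = Pal (p (col s i))" and j: "j \<le> 3 * n"
  shows "f (cyc n s j) = Pal (p (col s j))"
  using ij j
proof (induction j rule: dec_induct)
  case (step j)
  then obtain c where "c \<in> colours (cyc n s (Suc j))" "c \<noteq> col s j" "f (cyc n s (Suc j)) = Pal (p c)"
    using f_cyc_Pal_step[OF s, of j] by auto
  then show ?case using colours_cyc_cases[OF s, of "Suc j" n] step by auto
qed (rule fi)

lemma f_cyc_Pal_end:
  assumes s: "s < 2" and i: "i \<le> 3 * n" and fi: "f (cyc n s i) = Pal (p (col s i))"
  shows "\<exists>c\<in>{0, 1}. c \<noteq> s \<and> f X = Pal (p c)"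
  using f_cyc_Pal_step[OF s order_refl f_cyc_Pal_chain[OF s i fi order_refl]] by (auto simp: cyc_def col_def)

text \<open>A colour \<open>c\<close> at \<open>X\<close> starts the chain along the cycle
  \<open>c\<close>, whose end forces the other colour at \<open>X\<close>.\<close>

lemma f_X_inner: "f X \<in> inner m"
  using X_inner[of n]
proof (cases rule: f_inner_cases)
  case (2 c)
  then have c: "c < 2" by auto
  have "f (cyc n c 0) = Pal (p (col c 0))" using 2 by (simp add: cyc_def col_def)
  from f_cyc_Pal_end[OF c _ this] obtain d where "d \<in> {0, 1}" "d \<noteq> c" "f X = Pal (p d)" by auto
  then have "p c = p d" using 2 by simp
  then show ?thesis using p_inj[of c d] c \<open>d \<in> {0, 1}\<close> \<open>d \<noteq> c\<close> by auto
qed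

text \<open>After an inner image, a palette image cannot have the colour shared with the
  predecessor. It then has the colour shared with the successor, and the chain would send
  \<open>X\<close> to the palette.\<close>

lemma f_cyc_inner:
  assumes s: "s < 2"
  shows "i \<le> 3 * n + 1 \<Longrightarrow> f (cyc n s i) \<in> inner m"
proof (induction i)
  case 0
  then show ?case using f_X_inner by (simp add: cyc_def)
next
  case (Suc i)
  show ?case
  proof (cases "i = 3 * n")
    case True
    then show ?thesis using f_X_inner by (simp add: cyc_def)
  next
    case False
    then have i: "Suc i \<le> 3 * n" "i \<le> 3 * n" using Suc by auto
    have IH: "f (cyc n s i) \<in> inner m" using Suc by simp
    have v: "cyc n s i \<in> inner n" "cyc n s (Suc i) \<in> inner n" using s i by (auto intro!: cyc_inner)
    from v(2) show ?thesis
    proof (cases rule: f_inner_cases)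
      case (2 c)
      have c: "c = col s i \<or> c = col s (Suc i)"
        using 2 colours_cyc_cases[OF s _ i(1)] by auto
      have "colours (f (cyc n s i)) = p ` colours (cyc n s i)"
        using v(1) by (cases rule: f_inner_cases) (use IH in auto)
      then have "p (col s i) \<in> colours (f (cyc n s i))" using col_mem_cyc(1)[OF s i(2)] by auto
      moreover have "p c \<notin> colours (f (cyc n s i))"
        using f_edge[OF cyc_edge[OF s i(2)]] 2 IH by (simp add: Pal_inner_edge)
      ultimately have "f (cyc n s (Suc i)) = Pal (p (col s (Suc i)))" using c 2 by auto
      from f_cyc_Pal_end[OF s i(1) this] show ?thesis using f_X_inner by auto
    qed
  qed
qed

lemma colours_f_cyc:
  assumes "s < 2" "i \<le> 3 * n + 1"
  shows "colours (f (cyc n s i)) = p ` colours (cyc n s i)"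
  using cyc_inner[OF assms] by (cases rule: f_inner_cases) (use f_cyc_inner[OF assms] in auto)

lemma f_cyc_neq:
  assumes "s < 2" "i \<le> 3 * n + 1" "t < 2" "j \<le> 3 * n + 1" "colours (cyc n s i) \<noteq> colours (cyc n t j)"
  shows "f (cyc n s i) \<noteq> f (cyc n t j)"
proof
  assume "f (cyc n s i) = f (cyc n t j)"
  then have "p ` colours (cyc n s i) = p ` colours (cyc n t j)"
    using colours_f_cyc[of s i] colours_f_cyc[of t j] assms by simp
  then show False
    using assms inj_on_image_eq_iff[OF p_inj_on colours_inner(2) colours_inner(2)] cyc_inner by blast
qed

text \<open>Three neighbours of \<open>X\<close> have the distinct lists \<open>{0, 2}\<close>,
  \<open>{3, 0}\<close> and \<open>{1, 2}\<close>, hence distinct images, but \<open>Y s i\<close>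
  has at most two inner neighbours.\<close>

lemma f_X: "f X = X"
proof (rule ccontr)
  assume "f X \<noteq> X"
  then obtain s i where Y: "f X = Y s i" using f_X_inner by (auto elim: inner_cases)
  have nb: "f (cyc n t j) \<in> {cyc m s (i - 1), cyc m s (Suc i)}"
    if "t < 2" "j = 1 \<or> j = 3 * n" for t j
  proof -
    have "(X, cyc n t j) \<in> chain_graph n"
      using that n X_Y_edge(1)[of t j n] by (auto simp: cyc_def)
    then have "(Y s i, f (cyc n t j)) \<in> chain_graph m" using f_edge Y by metis
    moreover have "f (cyc n t j) \<in> inner m" using that n by (intro f_cyc_inner) auto
    ultimately show ?thesis using Y_neighbours f_X_inner Y by auto
  qed
  have col: "colours (cyc n t 1) = {t, 2}" "colours (cyc n t (3 * n)) = {3, t}" for t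
  proof -
    show "colours (cyc n t 1) = {t, 2}" using n by (simp add: cyc_def col_def flip: numeral_2_eq_2)
    obtain k where "n = Suc k" using n by (cases n) auto
    then have "3 * n - 1 = 2 + 3 * k" by simp
    then have "(3 * n - 1) mod 3 = 2" by (simp only: mod_mult_self2) simp
    then show "colours (cyc n t (3 * n)) = {3, t}" using n by (simp add: cyc_def col_def)
  qed
  have "f (cyc n 0 1) \<noteq> f (cyc n 0 (3 * n))" "f (cyc n 0 1) \<noteq> f (cyc n 1 1)"
    "f (cyc n 0 (3 * n)) \<noteq> f (cyc n 1 1)"
    using n by (intro f_cyc_neq; simp add: col[simplified] doubleton_eq_iff)+
  then show False using nb[of 0 1] nb[of 0 "3 * n"] nb[of 1 1] by auto
qed

text \<open>The image of the cycle 0 starts at \<open>X\<close> without backtracking, so it follows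
  the loop \<open>h\<close>, and the times of return to \<open>X\<close> are compared.\<close>

lemma sizes_eq: "n = m"
proof -
  let ?g = "\<lambda>i. f (cyc n 0 i)"
  have g_inner: "?g i \<in> inner m" if "i \<le> 3 * n + 1" for i using f_cyc_inner that by simp
  have g_edge: "(?g i, ?g (Suc i)) \<in> chain_graph m" if "i \<le> 3 * n" for i
    using f_edge cyc_edge that by simp
  have g0: "?g 0 = X" "?g (3 * n + 1) = X" using f_X by (simp_all add: cyc_def)
  obtain h where h: "h 0 = X" "h (Suc 0) = ?g (Suc 0)" "h (3 * m + 1) = X"
    "\<And>i. 1 \<le> i \<Longrightarrow> i \<le> 3 * m \<Longrightarrow> h i \<noteq> X"
    "\<And>i v. i < 3 * m \<Longrightarrow> v \<in> inner m \<Longrightarrow> (h (Suc i), v) \<in> chain_graph m \<Longrightarrow> v = h i \<or> v = h (Suc (Suc i))"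
    using loop_walk[OF m g_inner[of "Suc 0"]] g_edge[of 0] g0(1) n by auto
  have eq: "?g i = h i \<and> ?g (Suc i) = h (Suc i)" if "i \<le> 3 * n" "i \<le> 3 * m" for i
    using that
  proof (induction i)
    case 0
    then show ?case using g0 h by simp
  next
    case (Suc i)
    have "?g (Suc (Suc i)) = h i \<or> ?g (Suc (Suc i)) = h (Suc (Suc i))"
      using Suc g_edge[of "Suc i"] g_inner[of "Suc (Suc i)"] by (intro h(5)) auto
    moreover have "?g i \<noteq> ?g (Suc (Suc i))"
      using Suc colours_cyc_neq[of 0 i n] by (intro f_cyc_neq) auto
    ultimately show ?case using Suc by auto
  qed
  show ?thesis
  proof (rule linorder_cases[of n m])
    assume "n < m"
    then show ?thesis using eq[of "3 * n"] g0(2) h(4)[of "3 * n + 1"] by simp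
  next
    assume "m < n"
    then have "?g (3 * m + 1) = ?g 0" using eq[of "3 * m"] h(3) g0(1) by simp
    \<comment> \<open>The list at this position is \<open>{0, 2}\<close>, whereas \<open>X\<close>
      has the list \<open>{0, 1}\<close>.\<close>
    moreover have "colours (cyc n 0 (3 * m + 1)) \<noteq> colours (cyc n 0 0)"
      using \<open>m < n\<close> by (auto simp: cyc_def col_def doubleton_eq_iff mod_Suc)
    ultimately show ?thesis using f_cyc_neq[of 0 "3 * m + 1" 0 0] \<open>m < n\<close> by auto
  qed
qed

end

theorem theorem3p4:
  fixes V :: "'u::infinite alg set"
  assumes "variety V"
    and "\<forall>S\<in>V. ai_semiring S"
    and "\<forall>n::nat. n \<ge> 1 \<longrightarrow> (\<exists>S\<in>V. mult_isomorphic (mult_reduct S) (S_c (mset_set {1..n})))"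
  shows "subvarieties V \<approx> (UNIV :: nat set set)"
proof (rule lepoll_antisym[OF subvarieties_lepoll])
  \<comment> \<open>The sizes are shifted by one because \<open>chain_graph 0\<close> has a loop at
    \<open>X\<close>.\<close>
  have "j = k" if "graph_hom (chain_graph (Suc j)) (chain_graph (Suc k)) f" for j k f
    using chain_hom.sizes_eq[OF chain_hom.intro[OF _ _ that]] by simp
  then show "(UNIV :: nat set set) \<lesssim> subvarieties V"
    using lepoll_subvarieties_if_antichain[OF assms, of "\<lambda>k. chain_graph (Suc k)"]
      triangle_graph_chain by blast
qed

end
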